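(* Let $n\ge2$, let $F$ be a Minkowski norm on $\mathbb{R}^n$, let $\vec b=(\beta_1,\dots,\beta_p)$ ($p\le n$) be linearly independent 1-forms on $\mathbb{R}^n$, let $\phi$ be a smooth positive function of $p$ variables, and suppose that $\bar F=T_{\vec b,\phi}(F)$ is a Minkowski norm. If the Cartan torsions of $\bar F$ and $F$ coincide and $$(\phi-1)\Big(\phi\Big(\phi-\sum_{i}s_i\,\frac{\partial\phi}{\partial s_i}\Big)-1\Big)>0,$$ then $\phi(\vec b/F)\ne1$, and there is a Euclidean norm $\alpha$ on $\mathbb{R}^n$ such that $F=T_{\vec b,\phi_1}(\alpha)$ and $\bar F=T_{\vec b,\phi_2}(\alpha)$, with the same $\vec b$, for some function $\phi_1$ of $p$ variables and $\phi_2(s)=\phi_1(s)\,\phi\big(s/\phi_1(s)\big)$.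
   Context: A Minkowski norm on $\mathbb{R}^n$ ($n>1$) is a function $F:\mathbb{R}^n\to[0,\infty)$ that is $C^\infty$ on $\mathbb{R}^n\setminus\{0\}$, satisfies $F(\lambda y)=\lambda F(y)$ for $\lambda>0$, and such that for every $y\ne 0$ the symmetric bilinear form $g_y(u,v)=\frac12\frac{\partial^2}{\partial s\,\partial t}[F^2(y+su+tv)]_{|s=t=0}$ is positive definite. A Euclidean norm is the norm of an inner product. 1-forms on $\mathbb{R}^n$ are linear functionals. For a Minkowski norm $F$, a 1-form $\beta$ has norm $F(\beta)=\sup_{y\neq 0}|\beta(y)|/F(y)$. Given linearly independent 1-forms $\vec b=(\beta_1,\dots,\beta_p)$, $p\le n$, and a smooth function $\phi:\prod_{i=1}^p[-\delta_i,\delta_i]\to(0,\infty)$ with $F(\beta_i)<\delta_i$, the $T_{\vec b,\phi}$-deformation of $F$ is $T_{\vec b,\phi}(F)=F\cdot\phi(s)$, $s=(s_1,\dots,s_p)$, $s_i=\beta_i/F$; here $\vec b/F=(\beta_1/F,\dots,\beta_p/F)$. Standing assumption on deformations: $\phi-\sum_i s_i\,\partial\phi/\partial s_i>0$. The Cartan torsion of $F$ at $y\neq0$ is the symmetric trilinear form $C_y(u,v,w)=\frac14\frac{\partial^3}{\partial r\,\partial s\,\partial t}[F^2(y+ru+sv+tw)]_{|r=s=t=0}$. *)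

theory Defs
  imports "HOL-Analysis.Analysis"
begin

(* Derivatives are taken within S. They are unique when S is open or a closed box
   with nonempty interior; smoothness is used only for such S. *)
fun times_continuously_differentiable_on ::
    "nat \<Rightarrow> 'a::euclidean_space set \<Rightarrow> ('a \<Rightarrow> real) \<Rightarrow> bool" where
  "times_continuously_differentiable_on 0 S f \<longleftrightarrow> continuous_on S f"
| "times_continuously_differentiable_on (Suc k) S f \<longleftrightarrow>
     f differentiable_on S \<and>
     (\<forall>v. times_continuously_differentiable_on k S
           (\<lambda>x. frechet_derivative f (at x within S) v))"

definition smooth_on :: "'a::euclidean_space set \<Rightarrow> ('a \<Rightarrow> real) \<Rightarrow> bool" where
  "smooth_on S f \<longleftrightarrow> (\<forall>k. times_continuously_differentiable_on k S f)"

definition fundamental_form ::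
    "(real^'n \<Rightarrow> real) \<Rightarrow> real^'n \<Rightarrow> real^'n \<Rightarrow> real^'n \<Rightarrow> real" where
  "fundamental_form F y u v =
     1/2 * deriv (\<lambda>s. deriv (\<lambda>t. (F (y + s *\<^sub>R u + t *\<^sub>R v))\<^sup>2) 0) 0"

definition cartan_torsion ::
    "(real^'n \<Rightarrow> real) \<Rightarrow> real^'n \<Rightarrow> real^'n \<Rightarrow> real^'n \<Rightarrow> real^'n \<Rightarrow> real" where
  "cartan_torsion F y u v w =
     1/4 * deriv (\<lambda>r. deriv (\<lambda>s. deriv (\<lambda>t.
       (F (y + r *\<^sub>R u + s *\<^sub>R v + t *\<^sub>R w))\<^sup>2) 0) 0) 0"

(* Symmetry and bilinearity of the fundamental form follow from smoothness,
   so positive definiteness is the only condition on it. *)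
definition minkowski_norm :: "(real^'n \<Rightarrow> real) \<Rightarrow> bool" where
  "minkowski_norm F \<longleftrightarrow>
     (\<forall>y. 0 \<le> F y) \<and>
     smooth_on (UNIV - {0}) F \<and>
     (\<forall>y c. 0 < c \<longrightarrow> F (c *\<^sub>R y) = c * F y) \<and>
     (\<forall>y u. y \<noteq> 0 \<longrightarrow> u \<noteq> 0 \<longrightarrow> 0 < fundamental_form F y u u)"

definition inner_product :: "(real^'n \<Rightarrow> real^'n \<Rightarrow> real) \<Rightarrow> bool" where
  "inner_product B \<longleftrightarrow>
     bilinear B \<and> (\<forall>x y. B x y = B y x) \<and> (\<forall>x. x \<noteq> 0 \<longrightarrow> 0 < B x x)"

definition euclidean_norm :: "(real^'n \<Rightarrow> real) \<Rightarrow> bool" where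
  "euclidean_norm a \<longleftrightarrow> (\<exists>B. inner_product B \<and> (\<forall>x. a x = sqrt (B x x)))"

definition form_norm :: "(real^'n \<Rightarrow> real) \<Rightarrow> ((real^'n) \<Rightarrow>\<^sub>L real) \<Rightarrow> real" where
  "form_norm F b = (SUP y\<in>UNIV - {0}. \<bar>blinfun_apply b y\<bar> / F y)"

(* A tuple of 1-forms is a family indexed by a finite type 'p with CARD('p) = p;
   every linear functional on real^'n is bounded. *)
definition form_ratio ::
    "('p \<Rightarrow> (real^'n) \<Rightarrow>\<^sub>L real) \<Rightarrow> (real^'n \<Rightarrow> real) \<Rightarrow> real^'n \<Rightarrow> real^'p" where
  "form_ratio b F y = (\<chi> i. blinfun_apply (b i) y / F y)"

definition deformation ::
    "('p \<Rightarrow> (real^'n) \<Rightarrow>\<^sub>L real) \<Rightarrow> (real^'p \<Rightarrow> real) \<Rightarrow> (real^'n \<Rightarrow> real) \<Rightarrow> real^'n \<Rightarrow> real" where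
  "deformation b \<phi> F y = F y * \<phi> (form_ratio b F y)"

definition partial_deriv_within ::
    "(real^'p) set \<Rightarrow> (real^'p \<Rightarrow> real) \<Rightarrow> 'p \<Rightarrow> real^'p \<Rightarrow> real" where
  "partial_deriv_within D \<phi> i s = frechet_derivative \<phi> (at s within D) (axis i 1)"

definition radial_defect ::
    "(real^'p) set \<Rightarrow> (real^'p \<Rightarrow> real) \<Rightarrow> real^'p \<Rightarrow> real" where
  "radial_defect D \<phi> s = \<phi> s - (\<Sum>i\<in>UNIV. s $ i * partial_deriv_within D \<phi> i s)"

(* On real^'p the interval cbox (- d) d is the product of the intervals [- d $ i, d $ i]. *)
definition admissible_deformation ::
    "(real^'n \<Rightarrow> real) \<Rightarrow> ('p \<Rightarrow> (real^'n) \<Rightarrow>\<^sub>L real) \<Rightarrow> real^'p \<Rightarrow> (real^'p \<Rightarrow> real) \<Rightarrow> bool" where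
  "admissible_deformation F b d \<phi> \<longleftrightarrow>
     (\<forall>i. form_norm F (b i) < d $ i) \<and>
     smooth_on (cbox (- d) d) \<phi> \<and>
     (\<forall>s\<in>cbox (- d) d. 0 < \<phi> s) \<and>
     (\<forall>s\<in>cbox (- d) d. 0 < radial_defect (cbox (- d) d) \<phi> s)"

end

theory Submission
  imports Defs
begin

text \<open>
  The function \<open>Fbar\<^sup>2 - F\<^sup>2\<close> has vanishing third derivatives away from the origin, because
  these derivatives are the difference of the two Cartan torsions. The punctured space is connected
  in dimension at least 2, so the second derivatives are constant there, and Euler's identity for
  functions homogeneous of degree 2 makes \<open>Fbar\<^sup>2 - F\<^sup>2\<close> a quadratic form
  (\<open>quadratic_if_third_derivatives_vanish\<close>). It equals \<open>F\<^sup>2 (\<phi>\<^sup>2 - 1)\<close> with \<open>\<phi>\<close> evaluated at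
  \<open>\<beta>/F\<close>, and \<open>\<phi> - 1\<close> has one sign \<open>\<epsilon>\<close> on the connected box. Hence
  \<open>\<alpha> = sqrt (\<epsilon> (Fbar\<^sup>2 - F\<^sup>2))\<close> is a Euclidean norm, and \<open>\<alpha>\<close> is the deformation of \<open>F\<close>
  by \<open>\<psi> = sqrt (\<epsilon> (\<phi>\<^sup>2 - 1))\<close>.

  It remains to invert this deformation. As \<open>\<beta>/\<alpha>\<close> is the image of \<open>\<beta>/F\<close> under the radial map
  \<open>s \<mapsto> s / \<psi> s\<close>, one needs a smooth inverse of that map. The derivative of \<open>t / \<psi> (t s)\<close> in \<open>t\<close>
  has the sign of \<open>\<psi> - D\<psi>(s) s\<close> at \<open>t s\<close>, and multiplied by \<open>\<psi>\<close> this gap equals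
  \<open>\<epsilon> (\<phi> (\<phi> - D\<phi>(s) s) - 1)\<close>, which is positive by hypothesis. So the map is injective along
  rays, and its derivative, a rank-one perturbation of a multiple of the identity, is invertible.
  If \<open>g\<close> is the inverse, then \<open>\<phi>\<^sub>1 = 1 / (\<psi> \<circ> g)\<close> and \<open>\<phi>\<^sub>2 = (\<phi> / \<psi>) \<circ> g\<close>. Both are instances of
  one construction, \<open>pushforward\<close>, whose own gap is the quotient of the gap of the pushed
  function by that of \<open>\<psi>\<close> (\<open>pushforward_gap\<close>).

  The last difficulty is that \<open>\<phi>\<^sub>1\<close> and \<open>\<phi>\<^sub>2\<close> have to be defined on a whole box containing all values
  of \<open>\<beta>/\<alpha>\<close>, and the corners of such a box may lie outside the image of the radial map. Only the
  values of \<open>\<psi>\<close> on the smaller box bounding \<open>\<beta>/F\<close> matter, so outside that box \<open>\<psi>\<close> is damped by a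
  smooth factor that decreases along rays. Damping preserves the sign of the gap, and enough of it
  makes the image contain any prescribed cube (\<open>exists_truncated_radial_profile\<close>).
\<close>

section \<open>Continuously differentiable functions\<close>

abbreviation Cdiff :: "nat \<Rightarrow> 'a::euclidean_space set \<Rightarrow> ('a \<Rightarrow> real) \<Rightarrow> bool" where
  "Cdiff \<equiv> times_continuously_differentiable_on"

lemma frechet_derivative_within_cong:
  assumes "x \<in> S" "\<And>y. y \<in> S \<Longrightarrow> f y = g y"
  shows "frechet_derivative f (at x within S) = frechet_derivative g (at x within S)"
proof -
  have "(f has_derivative D) (at x within S) \<longleftrightarrow> (g has_derivative D) (at x within S)" for D
    using assms by (metis has_derivative_transform)
  then show ?thesis by (simp add: frechet_derivative_def)
qed

lemma Cdiff_cong: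
  assumes "\<And>x. x \<in> S \<Longrightarrow> f x = g x"
  shows "Cdiff k S f \<longleftrightarrow> Cdiff k S g"
  using assms
proof (induction k arbitrary: f g)
  case 0
  then show ?case by (simp cong: continuous_on_cong)
next
  case (Suc k)
  have 1: "Cdiff k S (\<lambda>x. frechet_derivative f (at x within S) v)
      \<longleftrightarrow> Cdiff k S (\<lambda>x. frechet_derivative g (at x within S) v)" for v
    by (rule Suc.IH) (metis Suc.prems frechet_derivative_within_cong)
  have 2: "f differentiable_on S \<longleftrightarrow> g differentiable_on S"
    using Suc.prems by (metis differentiable_on_def differentiable_transform_within zero_less_one)
  show ?case using 1 2 by simp
qed

text \<open>
  On an open set it suffices to know a derivative at each point; the within-derivatives and the
  choice hidden in \<^const>\<open>frechet_derivative\<close> disappear. Most closure properties below are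
  proved by induction through this rule.
\<close>

lemma Cdiff_SucI:
  assumes "open S"
    and der: "\<And>x. x \<in> S \<Longrightarrow> (f has_derivative f' x) (at x)"
    and "\<And>v. Cdiff k S (\<lambda>x. f' x v)"
  shows "Cdiff (Suc k) S f"
proof -
  have eq: "frechet_derivative f (at x within S) = f' x" if "x \<in> S" for x
    using der[OF that] assms(1) that by (simp add: at_within_open_NO_MATCH frechet_derivative_at[symmetric])
  have "f differentiable_on S"
    using der by (meson differentiable_at_imp_differentiable_on differentiableI)
  moreover have "Cdiff k S (\<lambda>x. frechet_derivative f (at x within S) v)" for v
    using assms(3)[of v] Cdiff_cong[of S "\<lambda>x. frechet_derivative f (at x within S) v" "\<lambda>x. f' x v" k] eq by simp
  ultimately show ?thesis by simp
qed

lemma Cdiff_Suc_has_derivative: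
  assumes "Cdiff (Suc k) S f" "open S" "x \<in> S"
  shows "(f has_derivative frechet_derivative f (at x)) (at x)"
proof -
  have "f differentiable (at x)"
    using assms by (metis at_within_open differentiable_on_def times_continuously_differentiable_on.simps(2))
  then show ?thesis by (simp add: frechet_derivative_works)
qed

lemma Cdiff_SucD:
  assumes "Cdiff (Suc k) S f" "open S"
  shows "Cdiff k S (\<lambda>x. frechet_derivative f (at x) v)"
proof -
  have "Cdiff k S (\<lambda>x. frechet_derivative f (at x within S) v)" using assms by simp
  then show ?thesis
    by (rule Cdiff_cong[THEN iffD1, rotated]) (use assms(2) in \<open>simp add: at_within_open_NO_MATCH\<close>)
qed

lemma Cdiff_SucE: "open S \<Longrightarrow> Cdiff (Suc k) S f \<Longrightarrow> Cdiff k S f"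
proof (induction k arbitrary: f)
  case 0
  then show ?case by (simp add: differentiable_imp_continuous_on)
next
  case (Suc k)
  show ?case
  proof (rule Cdiff_SucI[OF Suc.prems(1)])
    show "(f has_derivative frechet_derivative f (at x)) (at x)" if "x \<in> S" for x
      using Cdiff_Suc_has_derivative[OF Suc.prems(2,1) that] .
    show "Cdiff k S (\<lambda>x. frechet_derivative f (at x) v)" for v
      by (rule Suc.IH[OF Suc.prems(1) Cdiff_SucD[OF Suc.prems(2,1)]])
  qed
qed

lemma Cdiff_continuous_on: "open S \<Longrightarrow> Cdiff k S f \<Longrightarrow> continuous_on S f"
  by (induction k) (auto dest: Cdiff_SucE)

lemma Cdiff_const: "open S \<Longrightarrow> Cdiff k S (\<lambda>x. c)"
proof (induction k arbitrary: c)
  case (Suc k)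
  show ?case by (rule Cdiff_SucI[OF Suc.prems, of _ "\<lambda>x v. 0"]) (use Suc in auto)
qed simp

lemma Cdiff_bounded_linear: "open S \<Longrightarrow> bounded_linear f \<Longrightarrow> Cdiff k S f"
proof (cases k)
  case (Suc m)
  assume S: "open S" and f: "bounded_linear f"
  show ?thesis unfolding Suc
    by (rule Cdiff_SucI[OF S, of _ "\<lambda>x. f"]) (auto intro: bounded_linear_imp_has_derivative f Cdiff_const S)
qed (simp add: linear_continuous_on)

lemma Cdiff_add: "open S \<Longrightarrow> Cdiff k S f \<Longrightarrow> Cdiff k S g \<Longrightarrow> Cdiff k S (\<lambda>x. f x + g x)"
proof (induction k arbitrary: f g)
  case (Suc k)
  note S = Suc.prems(1)
  show ?case
    by (rule Cdiff_SucI[OF S has_derivative_add[OF Cdiff_Suc_has_derivative[OF Suc.prems(2) S]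
            Cdiff_Suc_has_derivative[OF Suc.prems(3) S]] Suc.IH[OF S]])
      (auto intro: Cdiff_SucD Suc.prems)
qed (simp add: continuous_on_add)

lemma Cdiff_sum:
  "open S \<Longrightarrow> (\<And>i. i \<in> I \<Longrightarrow> Cdiff k S (f i)) \<Longrightarrow> Cdiff k S (\<lambda>x. \<Sum>i\<in>I. f i x)"
  by (induction I rule: infinite_finite_induct) (auto intro: Cdiff_const Cdiff_add)

lemma Cdiff_mult: "open S \<Longrightarrow> Cdiff k S f \<Longrightarrow> Cdiff k S g \<Longrightarrow> Cdiff k S (\<lambda>x. f x * g x)"
proof (induction k arbitrary: f g)
  case (Suc k)
  note S = Suc.prems(1)
  show ?case
    by (rule Cdiff_SucI[OF S has_derivative_mult[OF Cdiff_Suc_has_derivative[OF Suc.prems(2) S]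
            Cdiff_Suc_has_derivative[OF Suc.prems(3) S]] Cdiff_add[OF S Suc.IH[OF S] Suc.IH[OF S]]])
      (auto intro: Cdiff_SucD Cdiff_SucE Suc.prems)
qed (simp add: continuous_on_mult)

text \<open>
  In coordinates the chain rule writes a directional derivative of \<open>h \<circ> f\<close> as a finite sum of
  products of a derivative of a component of \<open>f\<close> with \<open>(\<partial>\<^sub>i h) \<circ> f\<close>, to which the induction
  hypothesis applies since \<open>\<partial>\<^sub>i h\<close> is one order less regular.
\<close>

lemma Cdiff_compose:
  fixes f :: "'a::euclidean_space \<Rightarrow> 'b::euclidean_space" and h :: "'b \<Rightarrow> real"
  assumes S: "open S" and T: "open T" and sub: "f ` S \<subseteq> T"
  shows "(\<And>i. i \<in> Basis \<Longrightarrow> Cdiff k S (\<lambda>x. f x \<bullet> i)) \<Longrightarrow> Cdiff k T h \<Longrightarrow> Cdiff k S (\<lambda>x. h (f x))"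
proof (induction k arbitrary: h)
  case 0
  have "continuous_on S f"
    using 0(1) by (subst continuous_on_componentwise) auto
  then show ?case using 0 sub by (auto intro: continuous_on_compose2)
next
  case (Suc k)
  define D where "D x v = (\<Sum>i\<in>Basis. frechet_derivative (\<lambda>x. f x \<bullet> i) (at x) v *\<^sub>R i)" for x v
  have df: "(f has_derivative D x) (at x)" if "x \<in> S" for x
  proof (subst has_derivative_componentwise_within, intro ballI)
    fix i :: 'b assume i: "i \<in> Basis"
    have "(\<lambda>v. D x v \<bullet> i) = frechet_derivative (\<lambda>x. f x \<bullet> i) (at x)"
      using i by (auto simp: D_def inner_sum_left inner_Basis if_distrib cong: if_cong)
    then show "((\<lambda>x. f x \<bullet> i) has_derivative (\<lambda>v. D x v \<bullet> i)) (at x)"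
      using Cdiff_Suc_has_derivative[OF Suc.prems(1)[OF i] S that] by simp
  qed
  have dh: "(h has_derivative frechet_derivative h (at (f x))) (at (f x))" if "x \<in> S" for x
    using Cdiff_Suc_has_derivative[OF Suc.prems(2) T] sub that by blast
  show ?case
  proof (rule Cdiff_SucI[OF S has_derivative_compose[OF df dh]])
    fix v
    have eq: "frechet_derivative h (at (f x)) (D x v) =
      (\<Sum>i\<in>Basis. frechet_derivative (\<lambda>x. f x \<bullet> i) (at x) v * frechet_derivative h (at (f x)) i)"
      if "x \<in> S" for x
    proof -
      interpret bounded_linear "frechet_derivative h (at (f x))"
        using dh[OF that] by (rule has_derivative_bounded_linear)
      show ?thesis by (simp add: D_def sum scaleR)
    qed
    have "Cdiff k S (\<lambda>x. \<Sum>i\<in>Basis. frechet_derivative (\<lambda>x. f x \<bullet> i) (at x) v * frechet_derivative h (at (f x)) i)"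
      by (intro Cdiff_sum Cdiff_mult S Cdiff_SucD Suc.prems
          Suc.IH[where h = "\<lambda>z. frechet_derivative h (at z) i" for i] T)
         (auto intro: Cdiff_SucE[OF S] Suc.prems)
    then show "Cdiff k S (\<lambda>x. frechet_derivative h (at (f x)) (D x v))"
      by (rule Cdiff_cong[THEN iffD1, rotated]) (simp add: eq)
  qed auto
qed

lemma Cdiff_compose_real:
  fixes f :: "'a::euclidean_space \<Rightarrow> real"
  assumes "open S" "open T" "f ` S \<subseteq> T" "Cdiff k T h" "Cdiff k S f"
  shows "Cdiff k S (\<lambda>x. h (f x))"
  by (rule Cdiff_compose[OF assms(1,2,3)]) (use assms in auto)

lemma Cdiff_real_SucI:
  fixes f :: "real \<Rightarrow> real"
  assumes "open S" "\<And>x. x \<in> S \<Longrightarrow> (f has_real_derivative f' x) (at x)" "Cdiff k S f'"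
  shows "Cdiff (Suc k) S f"
  by (rule Cdiff_SucI[of S f "\<lambda>x v. f' x * v"])
    (use assms in \<open>auto simp: has_field_derivative_def intro!: Cdiff_mult Cdiff_const\<close>)

lemma Cdiff_exp: "Cdiff k UNIV (exp :: real \<Rightarrow> real)"
proof (induction k)
  case (Suc k)
  then show ?case by (intro Cdiff_real_SucI[of UNIV exp exp]) auto
qed (auto intro: continuous_intros)

lemma Cdiff_inverse: "Cdiff k {0<..} (inverse :: real \<Rightarrow> real)"
proof (induction k)
  case (Suc k)
  have "Cdiff k {0<..} (\<lambda>x::real. (-1) * (inverse x * inverse x))"
    by (intro Cdiff_mult Cdiff_const Suc) auto
  then show ?case
    by (intro Cdiff_real_SucI[of _ inverse "\<lambda>x. (-1) * (inverse x * inverse x)"])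
      (auto intro!: derivative_eq_intros simp: power2_eq_square)
qed (auto intro!: continuous_intros)

lemma Cdiff_sqrt: "Cdiff k {0<..} sqrt"
proof (induction k)
  case (Suc k)
  have "Cdiff k {0<..} (\<lambda>x::real. inverse (sqrt x))"
    by (rule Cdiff_compose_real[OF _ _ _ Cdiff_inverse Suc]) auto
  then have "Cdiff k {0<..} (\<lambda>x::real. inverse (sqrt x) * (1/2))"
    by (intro Cdiff_mult Cdiff_const) auto
  then show ?case
    by (intro Cdiff_real_SucI[of _ sqrt "\<lambda>x. inverse (sqrt x) * (1/2)"])
      (auto intro!: derivative_eq_intros simp: field_simps)
qed (auto intro!: continuous_intros)

text \<open>
  Derivatives within \<open>S\<close> and unrestricted derivatives agree on an open subset of \<open>S\<close>. This and the
  next lemma carry smoothness from a closed box to its interior, and from an open set to a closed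
  box inside it.
\<close>

lemma Cdiff_open_subset:
  assumes "open T" "T \<subseteq> S"
  shows "Cdiff k S f \<Longrightarrow> Cdiff k T f"
proof (induction k arbitrary: f)
  case 0
  then show ?case using assms by (auto intro: continuous_on_subset)
next
  case (Suc k)
  have w: "at x within S = at x" if "x \<in> T" for x
    using that assms by (meson at_within_interior interior_maximal subsetD)
  show ?case
  proof (rule Cdiff_SucI[OF assms(1)])
    show "(f has_derivative frechet_derivative f (at x)) (at x)" if "x \<in> T" for x
      using Suc.prems that w assms(2) unfolding times_continuously_differentiable_on.simps differentiable_on_def
      by (metis frechet_derivative_works subsetD)
    show "Cdiff k T (\<lambda>x. frechet_derivative f (at x) v)" for v
      using Suc.IH[of "\<lambda>x. frechet_derivative f (at x within S) v"] Suc.prems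
      by (subst Cdiff_cong[where g = "\<lambda>x. frechet_derivative f (at x within S) v"]) (auto simp: w)
  qed
qed

lemma Cdiff_cbox_subset:
  fixes f :: "'a::euclidean_space \<Rightarrow> real"
  assumes "open U" "cbox a b \<subseteq> U" "\<And>i. i \<in> Basis \<Longrightarrow> a \<bullet> i < b \<bullet> i"
  shows "Cdiff k U f \<Longrightarrow> Cdiff k (cbox a b) f"
proof (induction k arbitrary: f)
  case 0
  then show ?case using assms by (auto intro: continuous_on_subset)
next
  case (Suc k)
  have d: "(f has_derivative frechet_derivative f (at x)) (at x within cbox a b)" if "x \<in> cbox a b" for x
    using Cdiff_Suc_has_derivative[OF Suc.prems assms(1)] that assms(2)
    by (meson has_derivative_at_withinI subsetD)
  have eq: "frechet_derivative f (at x within cbox a b) = frechet_derivative f (at x)" if "x \<in> cbox a b" for x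
    by (rule frechet_derivative_within_cbox[OF assms(3) that d[OF that]])
  have "Cdiff k (cbox a b) (\<lambda>x. frechet_derivative f (at x within cbox a b) v)" for v
    using Suc.IH[OF Cdiff_SucD[OF Suc.prems assms(1)], of v]
    by (subst Cdiff_cong[where g = "\<lambda>x. frechet_derivative f (at x) v"]) (auto simp: eq)
  then show ?case using d by (auto simp: differentiable_on_def intro: differentiableI)
qed

section \<open>Flat functions\<close>

text \<open>
  The classical function \<open>exp (-1/x)\<close>, continued by zero, together with its products with powers
  of \<open>1/x\<close>. This larger family is closed under differentiation up to linear combinations, so
  smoothness of all its members follows by one induction.
\<close>

definition flat :: "nat \<Rightarrow> real \<Rightarrow> real" where
  "flat m x = (if x \<le> 0 then 0 else exp (- inverse x) * inverse x ^ m)"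

lemma tendsto_flat_0: "(flat m \<longlongrightarrow> 0) (at 0)"
proof (rule filterlim_split_at)
  have "eventually (\<lambda>x. flat m x = 0) (at_left 0)"
    by (auto simp: eventually_at_filter flat_def)
  then show "(flat m \<longlongrightarrow> 0) (at_left 0)" by (simp add: tendsto_eventually)
  have "((\<lambda>x::real. inverse x ^ m / exp (inverse x)) \<longlongrightarrow> 0) (at_right 0)"
    by (rule filterlim_compose[OF tendsto_power_div_exp_0 filterlim_inverse_at_top_right])
  moreover have "eventually (\<lambda>x. inverse x ^ m / exp (inverse x) = flat m x) (at_right 0)"
    by (auto simp: eventually_at_filter flat_def exp_minus field_simps)
  ultimately show "(flat m \<longlongrightarrow> 0) (at_right 0)" by (rule Lim_transform_eventually)
qed

lemma flat_has_derivative: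
  "(flat m has_real_derivative flat (m + 2) x - real m * flat (m + 1) x) (at x)"
proof -
  consider "x < 0" | "x = 0" | "x > 0" by linarith
  then show ?thesis
  proof cases
    case 1
    have "((\<lambda>x. 0) has_real_derivative 0) (at x)" by simp
    then have "(flat m has_real_derivative 0) (at x)"
      by (rule has_field_derivative_transform_within_open[of _ _ _ "{..<0}"]) (use 1 in \<open>auto simp: flat_def\<close>)
    then show ?thesis using 1 by (simp add: flat_def)
  next
    case 2
    have "((\<lambda>h. flat (m+1) h) \<longlongrightarrow> 0) (at 0)" by (rule tendsto_flat_0)
    moreover have "flat (m+1) h = (flat m (0 + h) - flat m 0) / h" for h
      by (simp add: flat_def field_simps)
    ultimately show ?thesis using 2 by (simp add: DERIV_def flat_def)
  next
    case 3
    have "((\<lambda>x. exp (- inverse x) * inverse x ^ m) has_real_derivative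
       (exp (- inverse x) * inverse x ^ (m+2) - real m * (exp (- inverse x) * inverse x ^ (m + 1)))) (at x)"
    proof -
      have "x \<noteq> 0" using 3 by simp
      show ?thesis
        by (rule derivative_eq_intros refl \<open>x \<noteq> 0\<close>)+
          (cases m; simp add: algebra_simps power2_eq_square)
    qed
    then have "(flat m has_real_derivative (exp (- inverse x) * inverse x ^ (m+2) - real m * (exp (- inverse x) * inverse x ^ (m + 1)))) (at x)"
      by (rule has_field_derivative_transform_within_open[of _ _ _ "{0<..}"]) (use 3 in \<open>auto simp: flat_def\<close>)
    then show ?thesis using 3 by (simp add: flat_def)
  qed
qed

lemma Cdiff_flat: "Cdiff k UNIV (flat m)"
proof (induction k arbitrary: m)
  case 0
  show ?case using flat_has_derivative by (auto intro!: continuous_at_imp_continuous_on DERIV_isCont)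
next
  case (Suc k)
  have "Cdiff k UNIV (\<lambda>x. flat (m + 2) x + (- real m) * flat (m + 1) x)"
    by (intro Cdiff_add Cdiff_mult Cdiff_const Suc) auto
  then show ?case
    by (intro Cdiff_real_SucI[OF _ flat_has_derivative]) auto
qed

section \<open>Inverting radial maps\<close>

text \<open>
  The setting for inverting the map \<open>x \<mapsto> x / \<psi> x\<close>. The assumption \<open>gap\<close> says that
  \<open>t / \<psi> (t x)\<close> is strictly increasing in \<open>t\<close>.
\<close>

locale radial_inversion =
  fixes X :: "'a::euclidean_space set" and \<psi> :: "'a \<Rightarrow> real"
  assumes open_X: "open X"
    and star: "\<And>x t. x \<in> X \<Longrightarrow> 0 \<le> t \<Longrightarrow> t \<le> 1 \<Longrightarrow> t *\<^sub>R x \<in> X"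
    and smooth: "smooth_on X \<psi>"
    and pos: "\<And>x. x \<in> X \<Longrightarrow> 0 < \<psi> x"
    and gap: "\<And>x. x \<in> X \<Longrightarrow> frechet_derivative \<psi> (at x) x < \<psi> x"
begin

abbreviation D :: "'a \<Rightarrow> 'a \<Rightarrow> real" where "D x \<equiv> frechet_derivative \<psi> (at x)"

definition radial :: "'a \<Rightarrow> 'a" where "radial x = (1 / \<psi> x) *\<^sub>R x"

definition radial_inv :: "'a \<Rightarrow> 'a" where "radial_inv = inv_into X radial"

lemma Cdiff_\<psi>: "Cdiff k X \<psi>"
  using smooth by (simp add: smooth_on_def)

lemma has_derivative_\<psi>: "x \<in> X \<Longrightarrow> (\<psi> has_derivative D x) (at x)"
  using Cdiff_Suc_has_derivative[OF Cdiff_\<psi> open_X] .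

text \<open>
  Two points of a ray with the same image under the radial map coincide, because \<open>t / \<psi> (t x)\<close>
  has positive derivative. The factor \<open>c\<close> is at most 1, so the segment between the two points stays
  in the star-shaped set \<open>X\<close>.
\<close>

lemma ray_ratio_eq_1:
  assumes x: "x \<in> X" and c: "0 < c" "c \<le> 1" and eq: "\<psi> (c *\<^sub>R x) = c * \<psi> x"
  shows "c = 1"
proof (rule ccontr)
  assume "c \<noteq> 1"
  then have "c < 1" using c by simp
  have "\<exists>y. ((\<lambda>t. t / \<psi> (t *\<^sub>R x)) has_real_derivative y) (at t) \<and> y > 0" if t: "c \<le> t" "t \<le> 1" for t
  proof -
    have tx: "t *\<^sub>R x \<in> X" using star[OF x] t c by simp
    interpret bounded_linear "D (t *\<^sub>R x)"
      using has_derivative_\<psi>[OF tx] by (rule has_derivative_bounded_linear)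
    have "((\<lambda>t. \<psi> (t *\<^sub>R x)) has_derivative (\<lambda>h. D (t *\<^sub>R x) (h *\<^sub>R x))) (at t)"
      by (rule has_derivative_compose[where f = "\<lambda>t. t *\<^sub>R x" and g = \<psi>])
        (auto intro!: derivative_eq_intros has_derivative_\<psi>[OF tx])
    then have "((\<lambda>t. \<psi> (t *\<^sub>R x)) has_real_derivative D (t *\<^sub>R x) x) (at t)"
      by (simp add: has_field_derivative_def scaleR mult.commute[of _ "D (t *\<^sub>R x) x"])
    then have "((\<lambda>t. t / \<psi> (t *\<^sub>R x)) has_real_derivative
        (1 * \<psi> (t *\<^sub>R x) - t * D (t *\<^sub>R x) x) / (\<psi> (t *\<^sub>R x) * \<psi> (t *\<^sub>R x))) (at t)"
      using pos[OF tx] by (intro DERIV_divide) (auto intro!: derivative_eq_intros)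
    moreover have "t * D (t *\<^sub>R x) x < \<psi> (t *\<^sub>R x)"
      using gap[OF tx] by (simp add: scaleR)
    ultimately show ?thesis using pos[OF tx]
      by (intro exI conjI) (assumption, simp)
  qed
  then have "c / \<psi> (c *\<^sub>R x) < 1 / \<psi> (1 *\<^sub>R x)"
    using DERIV_pos_imp_increasing[OF \<open>c < 1\<close>, of "\<lambda>t. t / \<psi> (t *\<^sub>R x)"] by blast
  then show False using eq c pos[OF x] by simp
qed

lemma inj_on_radial: "inj_on radial X"
proof (rule inj_onI)
  have le: "x = y" if xy: "x \<in> X" "y \<in> X" "radial x = radial y" "\<psi> y \<le> \<psi> x" for x y
  proof -
    define c where "c = \<psi> y / \<psi> x"
    have p: "0 < \<psi> x" "0 < \<psi> y" using pos xy by auto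
    have "c *\<^sub>R x = \<psi> y *\<^sub>R radial x" using p by (simp add: c_def radial_def)
    also have "\<dots> = y" using p by (simp add: xy(3)) (simp add: radial_def)
    finally have y: "y = c *\<^sub>R x" by simp
    have "0 < c" "c \<le> 1" using p xy(4) by (simp_all add: c_def)
    moreover have "\<psi> (c *\<^sub>R x) = c * \<psi> x" unfolding y[symmetric] using p by (simp add: c_def)
    ultimately have "c = 1" by (rule ray_ratio_eq_1[OF xy(1)])
    with y show ?thesis by simp
  qed
  show "x = y" if "x \<in> X" "y \<in> X" "radial x = radial y" for x y
    using le[OF that] le[OF that(2,1) that(3)[symmetric]] by (cases "\<psi> y \<le> \<psi> x") auto
qed

lemma radial_inv_radial: "x \<in> X \<Longrightarrow> radial_inv (radial x) = x"
  unfolding radial_inv_def by (rule inv_into_f_f[OF inj_on_radial])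

lemma radial_inv_in: "z \<in> radial ` X \<Longrightarrow> radial_inv z \<in> X"
  by (auto simp: radial_inv_radial)

lemma has_derivative_radial:
  assumes x: "x \<in> X"
  shows "(radial has_derivative (\<lambda>v. (1 / \<psi> x) *\<^sub>R v - (D x v / (\<psi> x)\<^sup>2) *\<^sub>R x)) (at x)"
proof -
  have "((\<lambda>x. 1 / \<psi> x) has_derivative (\<lambda>v. (0 * \<psi> x - 1 * D x v) / (\<psi> x * \<psi> x))) (at x)"
    using pos[OF x] by (intro has_derivative_divide' has_derivative_const has_derivative_\<psi>[OF x]) simp
  from has_derivative_scaleR[OF this has_derivative_ident] show ?thesis
    unfolding radial_def[abs_def] by (rule has_derivative_eq_rhs) (simp add: fun_eq_iff power2_eq_square)
qed

lemma continuous_on_radial: "continuous_on X radial"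
  by (meson has_derivative_radial has_derivative_continuous continuous_at_imp_continuous_on)

lemma open_radial_image: "open (radial ` X)"
  using invariance_of_domain[OF continuous_on_radial open_X inj_on_radial] .

text \<open>
  The derivative of the radial map is \<open>1/\<psi>\<close> times the identity plus a rank-one term; the
  Sherman--Morrison formula inverts it, with the gap of \<open>\<psi>\<close> as denominator.
\<close>

lemma has_derivative_radial_inv:
  assumes x: "x \<in> X"
  shows "(radial_inv has_derivative
           (\<lambda>v. \<psi> x *\<^sub>R v + (\<psi> x * D x v / (\<psi> x - D x x)) *\<^sub>R x)) (at (radial x))"
proof (rule has_derivative_inverse_strong[OF open_X x continuous_on_radial radial_inv_radial
      has_derivative_radial[OF x]])
  interpret bounded_linear "D x"
    using has_derivative_\<psi>[OF x] by (rule has_derivative_bounded_linear)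
  have p: "\<psi> x \<noteq> 0" "\<psi> x - D x x \<noteq> 0" using pos[OF x] gap[OF x] by auto
  show "(\<lambda>v. (1 / \<psi> x) *\<^sub>R v - (D x v / (\<psi> x)\<^sup>2) *\<^sub>R x) \<circ>
    (\<lambda>v. \<psi> x *\<^sub>R v + (\<psi> x * D x v / (\<psi> x - D x x)) *\<^sub>R x) = id"
  proof (rule ext)
    fix v
    have "(1 / \<psi> x) * (\<psi> x * D x v / (\<psi> x - D x x))
      = D x (\<psi> x *\<^sub>R v + (\<psi> x * D x v / (\<psi> x - D x x)) *\<^sub>R x) / (\<psi> x)\<^sup>2"
      using p by (simp add: add scaleR divide_simps power2_eq_square) (simp add: algebra_simps)
    then show "((\<lambda>v. (1 / \<psi> x) *\<^sub>R v - (D x v / (\<psi> x)\<^sup>2) *\<^sub>R x) \<circ>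
      (\<lambda>v. \<psi> x *\<^sub>R v + (\<psi> x * D x v / (\<psi> x - D x x)) *\<^sub>R x)) v = id v"
      using p(1) by (simp add: scaleR_add_right)
  qed
qed

text \<open>
  The gap contains the derivative at \<open>x\<close> in the varying direction \<open>x\<close>; expanding \<open>x\<close> in the basis
  reduces it to directional derivatives in fixed directions.
\<close>

lemma Cdiff_gap: "Cdiff k X (\<lambda>x. \<psi> x - D x x)"
proof -
  have "Cdiff k X (\<lambda>x. \<psi> x + (\<Sum>i\<in>Basis. (x \<bullet> i) * ((-1) * D x i)))"
    by (intro Cdiff_add Cdiff_sum Cdiff_mult Cdiff_const Cdiff_\<psi> Cdiff_SucD open_X
        Cdiff_bounded_linear bounded_linear_inner_left)
  moreover have "\<psi> x + (\<Sum>i\<in>Basis. (x \<bullet> i) * ((-1) * D x i)) = \<psi> x - D x x" if "x \<in> X" for x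
  proof -
    interpret bounded_linear "D x"
      using has_derivative_\<psi>[OF that] by (rule has_derivative_bounded_linear)
    have "D x x = D x (\<Sum>i\<in>Basis. (x \<bullet> i) *\<^sub>R i)" by (simp add: euclidean_representation)
    also have "\<dots> = (\<Sum>i\<in>Basis. (x \<bullet> i) * D x i)" by (simp only: sum scaleR real_scaleR_def)
    finally show ?thesis by (simp add: sum_negf)
  qed
  ultimately show ?thesis by (simp cong: Cdiff_cong)
qed

text \<open>
  Bootstrapping: the formula for the derivative of the inverse involves only the inverse itself and
  smooth functions evaluated at it, so it is as regular as the inverse, which therefore gains one
  order.
\<close>

lemma Cdiff_radial_inv: "Cdiff k (radial ` X) (\<lambda>z. radial_inv z \<bullet> i)"
proof (induction k arbitrary: i)
  case 0
  have "isCont radial_inv z" if "z \<in> radial ` X" for z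
    using that has_derivative_radial_inv has_derivative_continuous by blast
  then show ?case by (auto intro!: continuous_at_imp_continuous_on continuous_intros)
next
  case (Suc k)
  note oi = open_radial_image
  have comp: "Cdiff k (radial ` X) (\<lambda>z. h (radial_inv z))" if "Cdiff k X h" for h
    by (rule Cdiff_compose[OF oi open_X _ Suc.IH that]) (auto simp: radial_inv_radial)
  have inv: "Cdiff k X (\<lambda>x. inverse (\<psi> x - D x x))"
    by (rule Cdiff_compose_real[OF open_X _ _ Cdiff_inverse Cdiff_gap]) (auto simp: gap)
  show ?case
  proof (rule Cdiff_SucI[OF oi])
    fix z assume "z \<in> radial ` X"
    then show "((\<lambda>z. radial_inv z \<bullet> i) has_derivative
      (\<lambda>v. \<psi> (radial_inv z) * (v \<bullet> i) + \<psi> (radial_inv z) * D (radial_inv z) v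
        * inverse (\<psi> (radial_inv z) - D (radial_inv z) (radial_inv z)) * (radial_inv z \<bullet> i))) (at z)"
      by (auto simp: radial_inv_radial inner_add_left divide_inverse
          intro!: derivative_eq_intros has_derivative_radial_inv)
  next
    show "Cdiff k (radial ` X) (\<lambda>z. \<psi> (radial_inv z) * (v \<bullet> i) + \<psi> (radial_inv z) * D (radial_inv z) v
        * inverse (\<psi> (radial_inv z) - D (radial_inv z) (radial_inv z)) * (radial_inv z \<bullet> i))" for v
      by (intro Cdiff_add Cdiff_mult Cdiff_const oi Suc comp[OF Cdiff_\<psi>] comp[OF inv]
          comp[OF Cdiff_SucD[OF Cdiff_\<psi> open_X]])
  qed
qed

text \<open>
  If \<open>\<alpha> = F \<psi>(\<beta>/F)\<close>, then \<open>F h(\<beta>/F)\<close> is the deformation of \<open>\<alpha>\<close> by \<open>pushforward h\<close>.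
\<close>

definition pushforward :: "('a \<Rightarrow> real) \<Rightarrow> 'a \<Rightarrow> real" where
  "pushforward h z = h (radial_inv z) / \<psi> (radial_inv z)"

lemma Cdiff_pushforward:
  assumes "Cdiff k X h"
  shows "Cdiff k (radial ` X) (pushforward h)"
proof -
  have "Cdiff k X (\<lambda>x. h x * inverse (\<psi> x))"
    by (intro Cdiff_mult open_X assms Cdiff_compose_real[OF open_X _ _ Cdiff_inverse Cdiff_\<psi>])
      (auto simp: pos)
  then have "Cdiff k (radial ` X) (\<lambda>z. h (radial_inv z) * inverse (\<psi> (radial_inv z)))"
    by (rule Cdiff_compose[OF open_radial_image open_X _ Cdiff_radial_inv, rotated])
      (auto simp: radial_inv_radial)
  then show ?thesis by (simp add: pushforward_def[abs_def] divide_inverse)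
qed

text \<open>
  Moving \<open>radial x\<close> along its own ray moves the preimage along the ray of \<open>x\<close> with speed
  \<open>\<psi> / (\<psi> - D\<psi>(x) x)\<close>; substituting this into the quotient rule cancels every term except the gap
  of \<open>h\<close>.
\<close>

lemma pushforward_gap:
  assumes x: "x \<in> X" and h: "(h has_derivative h') (at x)"
  shows "pushforward h (radial x) - frechet_derivative (pushforward h) (at (radial x)) (radial x)
    = (h x - h' x) / (\<psi> x - D x x)"
proof -
  interpret bounded_linear "D x"
    using has_derivative_\<psi>[OF x] by (rule has_derivative_bounded_linear)
  interpret h': bounded_linear h' using h by (rule has_derivative_bounded_linear)
  have p: "\<psi> x \<noteq> 0" "\<psi> x - D x x \<noteq> 0" using pos[OF x] gap[OF x] by auto
  define L where "L v = \<psi> x *\<^sub>R v + (\<psi> x * D x v / (\<psi> x - D x x)) *\<^sub>R x" for v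
  have L: "(radial_inv has_derivative L) (at (radial x))"
    using has_derivative_radial_inv[OF x] by (simp add: L_def[abs_def])
  have Lx: "L (radial x) = (\<psi> x / (\<psi> x - D x x)) *\<^sub>R x"
  proof -
    have "1 + D x x / (\<psi> x - D x x) = \<psi> x / (\<psi> x - D x x)" using p by (simp add: field_simps)
    then show ?thesis using p(1) unfolding L_def radial_def scaleR
      by (simp add: scaleR_left_distrib[symmetric])
         (metis scaleR_left_distrib scaleR_one)
  qed
  have "((\<lambda>z. h (radial_inv z) / \<psi> (radial_inv z)) has_derivative
      (\<lambda>v. (h' (L v) * \<psi> x - h x * D x (L v)) / (\<psi> x * \<psi> x))) (at (radial x))"
    using has_derivative_divide'[OF has_derivative_compose[OF L, of h h'] has_derivative_compose[OF L, of \<psi> "D x"]]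
      h has_derivative_\<psi>[OF x] p(1) by (simp add: radial_inv_radial[OF x])
  then have "frechet_derivative (pushforward h) (at (radial x))
      = (\<lambda>v. (h' (L v) * \<psi> x - h x * D x (L v)) / (\<psi> x * \<psi> x))"
    unfolding pushforward_def[abs_def] by (rule frechet_derivative_at[symmetric])
  then show ?thesis using p
    by (simp add: Lx scaleR h'.scaleR pushforward_def radial_inv_radial[OF x] divide_simps)
       (simp add: algebra_simps)
qed

end

section \<open>Damping a radial profile\<close>

text \<open>
  The factor \<open>exp (- \<Lambda> E)\<close>, where \<open>E\<close> adds up flat functions of \<open>(x\<^sub>i)\<^sup>2 - (a\<^sub>i)\<^sup>2\<close>, equals 1 on the box
  with half-widths \<open>a\<close> and decreases along rays outside it, so multiplying \<open>\<psi>\<close> by it only enlarges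
  the gap relative to \<open>\<psi>\<close>. On the boundary of an intermediate box the damped profile is arbitrarily small
  for large \<open>\<Lambda>\<close>, so the radial map sends the part of a ray inside that box past any given
  distance, and the intermediate value theorem along the ray gives preimages.
\<close>

lemma exists_truncated_radial_profile:
  fixes d :: "'a::euclidean_space" and \<psi> :: "'a \<Rightarrow> real"
  assumes smooth: "smooth_on (box (- d) d) \<psi>"
    and pos: "\<And>x. x \<in> box (- d) d \<Longrightarrow> 0 < \<psi> x"
    and bound: "\<And>x. x \<in> box (- d) d \<Longrightarrow> \<psi> x \<le> M"
    and gap: "\<And>x. x \<in> box (- d) d \<Longrightarrow> frechet_derivative \<psi> (at x) x < \<psi> x"
    and a: "\<And>i. i \<in> Basis \<Longrightarrow> 0 \<le> a i" "\<And>i. i \<in> Basis \<Longrightarrow> a i < d \<bullet> i"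
    and K: "0 < K"
  obtains \<psi>' where "radial_inversion (box (- d) d) \<psi>'"
    and "\<And>x. (\<And>i. i \<in> Basis \<Longrightarrow> \<bar>x \<bullet> i\<bar> \<le> a i) \<Longrightarrow> \<psi>' x = \<psi> x"
    and "\<And>z. (\<And>i. i \<in> Basis \<Longrightarrow> \<bar>z \<bullet> i\<bar> \<le> K) \<Longrightarrow> z \<in> radial_inversion.radial \<psi>' ` box (- d) d"
proof -
  let ?X = "box (- d) d"
  define E where "E x = (\<Sum>i\<in>Basis. flat 0 ((x \<bullet> i)\<^sup>2 - (a i)\<^sup>2))" for x :: 'a
  define c where "c i = (a i + d \<bullet> i) / 2" for i
  have ac: "a i < c i" "c i < d \<bullet> i" "0 < c i" if "i \<in> Basis" for i
    using a[OF that] by (auto simp: c_def)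
  have flat_nonneg: "0 \<le> flat m x" for m x by (simp add: flat_def)
  have in_X: "x \<in> ?X" if "\<And>i. i \<in> Basis \<Longrightarrow> \<bar>x \<bullet> i\<bar> \<le> c i" for x
    using that ac by (fastforce simp: mem_box abs_le_iff)
  have zero: "0 \<in> ?X" using in_X[of 0] ac by (simp add: less_imp_le)
  have M: "0 < M" using pos[OF zero] bound[OF zero] by simp
  define \<eta> where "\<eta> = Min ((\<lambda>i. flat 0 ((c i)\<^sup>2 - (a i)\<^sup>2)) ` Basis)"
  define c0 where "c0 = Min (c ` Basis)"
  have \<eta>: "0 < \<eta>" "\<And>i. i \<in> Basis \<Longrightarrow> \<eta> \<le> flat 0 ((c i)\<^sup>2 - (a i)\<^sup>2)"
  proof -
    have "0 < flat 0 ((c i)\<^sup>2 - (a i)\<^sup>2)" if i: "i \<in> Basis" for i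
      using power_strict_mono[OF ac(1)[OF i] a(1)[OF i], of 2] by (simp add: flat_def)
    then show "0 < \<eta>" by (simp add: \<eta>_def)
  qed (simp add: \<eta>_def)
  have c0: "0 < c0" "\<And>i. i \<in> Basis \<Longrightarrow> c0 \<le> c i"
    using ac by (simp_all add: c0_def)
  \<comment> \<open>Chosen so that \<open>M exp (- \<Lambda> \<eta>) \<le> c0 / K\<close>, by \<open>exp t \<ge> t\<close>.\<close>
  define \<Lambda> where "\<Lambda> = M * K / (c0 * \<eta>)"
  have \<Lambda>: "0 < \<Lambda>" using M K c0 \<eta> by (simp add: \<Lambda>_def)
  have small: "M * exp (- (\<Lambda> * \<eta>)) \<le> c0 / K"
  proof -
    have "M * K / c0 = \<Lambda> * \<eta>" using c0 \<eta> by (simp add: \<Lambda>_def)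
    also have "\<dots> \<le> exp (\<Lambda> * \<eta>)" using exp_ge_add_one_self[of "\<Lambda> * \<eta>"] by linarith
    finally show ?thesis using c0 K M by (simp add: exp_minus field_simps)
  qed
  define k where "k x = exp (- \<Lambda> * E x)" for x
  define \<psi>' where "\<psi>' x = \<psi> x * k x" for x
  have E_der: "(E has_derivative
      (\<lambda>v. \<Sum>i\<in>Basis. flat 2 ((x \<bullet> i)\<^sup>2 - (a i)\<^sup>2) * (2 * (x \<bullet> i) * (v \<bullet> i)))) (at x)" for x
  proof -
    have "((\<lambda>x. flat 0 ((x \<bullet> i)\<^sup>2 - (a i)\<^sup>2)) has_derivative
      (\<lambda>v. flat 2 ((x \<bullet> i)\<^sup>2 - (a i)\<^sup>2) * (2 * (x \<bullet> i) * (v \<bullet> i)))) (at x)" for i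
    proof (rule has_derivative_compose[where f = "\<lambda>x. (x \<bullet> i)\<^sup>2 - (a i)\<^sup>2" and g = "flat 0"
          and f' = "\<lambda>v. 2 * (x \<bullet> i) * (v \<bullet> i)" and g' = "(*) (flat 2 ((x \<bullet> i)\<^sup>2 - (a i)\<^sup>2))"])
      show "((\<lambda>x. (x \<bullet> i)\<^sup>2 - (a i)\<^sup>2) has_derivative (\<lambda>v. 2 * (x \<bullet> i) * (v \<bullet> i))) (at x)"
        by (auto intro!: derivative_eq_intros)
      show "(flat 0 has_derivative (*) (flat 2 ((x \<bullet> i)\<^sup>2 - (a i)\<^sup>2))) (at ((x \<bullet> i)\<^sup>2 - (a i)\<^sup>2))"
        using flat_has_derivative[of 0] by (simp add: has_field_derivative_def numeral_2_eq_2)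
    qed
    then show ?thesis unfolding E_def[abs_def] by (intro has_derivative_sum)
  qed
  have k_der: "(k has_derivative (\<lambda>v. k x * (- \<Lambda> *
      (\<Sum>i\<in>Basis. flat 2 ((x \<bullet> i)\<^sup>2 - (a i)\<^sup>2) * (2 * (x \<bullet> i) * (v \<bullet> i)))))) (at x)" for x
    unfolding k_def[abs_def]
    by (rule derivative_eq_intros E_der refl)+ (auto simp: fun_eq_iff)
  have ray: "t *\<^sub>R x \<in> ?X" if "x \<in> ?X" "0 \<le> t" "t \<le> 1" for x t
    using convexD[OF convex_box(2), of x "-d" d 0 t "1 - t"] that zero by simp
  have "Cdiff n ?X \<psi>'" for n
  proof -
    have "Cdiff n UNIV (\<lambda>x::'a. (x \<bullet> i) * (x \<bullet> i) + - (a i)\<^sup>2)" for i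
      by (intro Cdiff_add Cdiff_mult Cdiff_const Cdiff_bounded_linear bounded_linear_inner_left open_UNIV)
    then have "Cdiff n UNIV (\<lambda>x::'a. (x \<bullet> i)\<^sup>2 - (a i)\<^sup>2)" for i
      by (simp add: power2_eq_square)
    then have "Cdiff n UNIV (\<lambda>x::'a. flat 0 ((x \<bullet> i)\<^sup>2 - (a i)\<^sup>2))" for i
      by (intro Cdiff_compose_real[where h = "flat 0", OF open_UNIV open_UNIV _ Cdiff_flat]) auto
    then have "Cdiff n UNIV (\<lambda>x. - \<Lambda> * E x)"
      unfolding E_def[abs_def] by (intro Cdiff_mult Cdiff_const Cdiff_sum open_UNIV)
    then have "Cdiff n UNIV k" unfolding k_def[abs_def]
      by (intro Cdiff_compose_real[where h = exp, OF open_UNIV open_UNIV _ Cdiff_exp]) auto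
    then show ?thesis unfolding \<psi>'_def[abs_def]
      using smooth by (intro Cdiff_mult) (auto simp: smooth_on_def intro: Cdiff_open_subset)
  qed
  then have smooth': "smooth_on ?X \<psi>'" by (simp add: smooth_on_def)
  have pos': "0 < \<psi>' x" if "x \<in> ?X" for x
    using pos[OF that] by (simp add: \<psi>'_def k_def)
  have gap': "frechet_derivative \<psi>' (at x) x < \<psi>' x" if x: "x \<in> ?X" for x
  proof -
    have d: "(\<psi> has_derivative frechet_derivative \<psi> (at x)) (at x)"
      using smooth x Cdiff_Suc_has_derivative[of 0] by (metis open_box smooth_on_def)
    define S where "S = (\<Sum>i\<in>Basis. flat 2 ((x \<bullet> i)\<^sup>2 - (a i)\<^sup>2) * (2 * (x \<bullet> i) * (x \<bullet> i)))"
    have "0 \<le> S" unfolding S_def by (intro sum_nonneg mult_nonneg_nonneg[OF flat_nonneg]) (simp add: mult.assoc)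
    have "frechet_derivative \<psi>' (at x) x
        = \<psi> x * (k x * (- \<Lambda> * S)) + frechet_derivative \<psi> (at x) x * k x"
      unfolding \<psi>'_def[abs_def] S_def
      by (subst frechet_derivative_at[OF has_derivative_mult[OF d k_der], symmetric]) simp
    also have "\<dots> \<le> frechet_derivative \<psi> (at x) x * k x"
      using pos[OF x] \<open>0 \<le> S\<close> \<Lambda> by (simp add: k_def)
    also have "\<dots> < \<psi> x * k x"
      using gap[OF x] by (simp add: k_def)
    finally show ?thesis by (simp add: \<psi>'_def)
  qed
  interpret radial_inversion ?X \<psi>'
    by unfold_locales (use ray smooth' pos' gap' in auto)
  show ?thesis
  proof (rule that)
    show "radial_inversion ?X \<psi>'" ..
  next
    fix x :: 'a assume x: "\<And>i. i \<in> Basis \<Longrightarrow> \<bar>x \<bullet> i\<bar> \<le> a i"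
    have "(x \<bullet> i)\<^sup>2 \<le> (a i)\<^sup>2" if "i \<in> Basis" for i
      using x[OF that] a(1)[OF that] by (simp add: abs_le_square_iff[symmetric])
    then have "E x = 0" by (simp add: E_def flat_def)
    then show "\<psi>' x = \<psi> x" by (simp add: \<psi>'_def k_def)
  next
    fix z :: 'a assume z: "\<And>i. i \<in> Basis \<Longrightarrow> \<bar>z \<bullet> i\<bar> \<le> K"
    show "z \<in> radial ` ?X"
    proof (cases "z = 0")
      case True
      then show ?thesis using zero by (auto intro!: image_eqI[of _ _ 0] simp: radial_def)
    next
      case False
      \<comment> \<open>The time at which the ray through \<open>z\<close> leaves the intermediate box.\<close>
      define T where "T = Min ((\<lambda>i. c i / \<bar>z \<bullet> i\<bar>) ` {i\<in>Basis. z \<bullet> i \<noteq> 0})"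
      have ne: "{i\<in>Basis. z \<bullet> i \<noteq> 0} \<noteq> {}" using False euclidean_all_zero_iff[of z] by auto
      have "T \<in> (\<lambda>i. c i / \<bar>z \<bullet> i\<bar>) ` {i\<in>Basis. z \<bullet> i \<noteq> 0}"
        unfolding T_def using ne by (intro Min_in) auto
      then obtain j where j: "j \<in> Basis" "z \<bullet> j \<noteq> 0" "T = c j / \<bar>z \<bullet> j\<bar>" by auto
      have T_le: "T * \<bar>z \<bullet> i\<bar> \<le> c i" if i: "i \<in> Basis" for i
      proof (cases "z \<bullet> i = 0")
        case False
        then have "T \<le> c i / \<bar>z \<bullet> i\<bar>" unfolding T_def using i by (intro Min_le) auto
        then show ?thesis using False by (simp add: field_simps)
      qed (use ac[OF i] in simp)
      have T0: "0 < T" using j ac by simp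
      have tz: "t *\<^sub>R z \<in> ?X" if "0 \<le> t" "t \<le> T" for t
      proof (rule in_X)
        fix i :: 'a assume "i \<in> Basis"
        then show "\<bar>t *\<^sub>R z \<bullet> i\<bar> \<le> c i"
          using T_le[of i] mult_right_mono[OF that(2), of "\<bar>z \<bullet> i\<bar>"] that(1) by (simp add: abs_mult)
      qed
      have "\<psi>' (T *\<^sub>R z) \<le> T"
      proof -
        have "flat 0 ((T *\<^sub>R z \<bullet> j)\<^sup>2 - (a j)\<^sup>2) \<le> E (T *\<^sub>R z)"
          unfolding E_def using j(1) by (intro member_le_sum) (auto simp: flat_nonneg)
        moreover have "(T *\<^sub>R z \<bullet> j)\<^sup>2 = (c j)\<^sup>2"
          using j by (simp add: power_mult_distrib power_divide)
        ultimately have "\<eta> \<le> E (T *\<^sub>R z)" using \<eta>(2)[OF j(1)] by simp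
        then have "k (T *\<^sub>R z) \<le> exp (- (\<Lambda> * \<eta>))" using \<Lambda> by (simp add: k_def)
        then have "\<psi>' (T *\<^sub>R z) \<le> M * exp (- (\<Lambda> * \<eta>))"
          unfolding \<psi>'_def using bound[OF tz[of T]] M T0 by (intro mult_mono) (auto simp: k_def)
        also have "\<dots> \<le> c0 / K" by (rule small)
        also have "\<dots> \<le> c j / \<bar>z \<bullet> j\<bar>"
          using c0 j z[OF j(1)] ac(3)[OF j(1)] by (intro frac_le) auto
        finally show ?thesis by (simp add: j(3))
      qed
      moreover have "0 \<le> \<psi>' (0 *\<^sub>R z)" using pos'[OF zero] by simp
      moreover have "continuous_on {0..T} (\<lambda>t. \<psi>' (t *\<^sub>R z))"
        by (rule continuous_on_compose2[OF Cdiff_continuous_on[OF open_X Cdiff_\<psi>[of 0]]])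
          (auto intro!: continuous_intros tz)
      then have "continuous_on {0..T} (\<lambda>t. t - \<psi>' (t *\<^sub>R z))"
        by (intro continuous_on_diff continuous_on_id)
      \<comment> \<open>A zero of \<open>t - \<psi>' (t z)\<close> is a point \<open>t z\<close> whose radial image is \<open>z\<close>.\<close>
      ultimately obtain t where t: "0 \<le> t" "t \<le> T" "t - \<psi>' (t *\<^sub>R z) = 0"
        using IVT'[of "\<lambda>t. t - \<psi>' (t *\<^sub>R z)" 0 0 T] T0 by auto
      have "radial (t *\<^sub>R z) = z" using t pos'[OF tz[OF t(1,2)]] by (simp add: radial_def)
      then show ?thesis using tz[OF t(1,2)] by (metis image_eqI)
    qed
  qed
qed

section \<open>Third derivatives and quadratic forms\<close>

abbreviation dir_deriv :: "('a::real_normed_vector \<Rightarrow> real) \<Rightarrow> 'a \<Rightarrow> 'a \<Rightarrow> real" where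
  "dir_deriv f v x \<equiv> frechet_derivative f (at x) v"

lemma open_punctured [simp]: "open (UNIV - {0 :: 'a::real_normed_vector})"
  by (rule open_delete) simp

lemma eventually_line_in_open:
  fixes y u :: "'a::real_normed_vector"
  assumes "open S" "y \<in> S"
  shows "\<forall>\<^sub>F s in nhds 0. y + s *\<^sub>R u \<in> S"
proof -
  have "((\<lambda>s. y + s *\<^sub>R u) \<longlongrightarrow> y + 0 *\<^sub>R u) (nhds 0)"
    by (intro tendsto_intros filterlim_ident)
  then show ?thesis using assms by (intro topological_tendstoD[where S = S]) auto
qed

lemma deriv_along_line:
  fixes f :: "'a::euclidean_space \<Rightarrow> real"
  assumes "Cdiff (Suc k) S f" "open S" "x \<in> S"
  shows "deriv (\<lambda>t. f (x + t *\<^sub>R w)) 0 = dir_deriv f w x"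
proof -
  have f: "(f has_derivative frechet_derivative f (at x)) (at x)"
    by (rule Cdiff_Suc_has_derivative[OF assms])
  interpret bounded_linear "frechet_derivative f (at x)"
    using f by (rule has_derivative_bounded_linear)
  have "((\<lambda>t. f (x + t *\<^sub>R w)) has_derivative (\<lambda>h. frechet_derivative f (at x) (h *\<^sub>R w))) (at 0)"
    by (rule has_derivative_compose[where f = "\<lambda>t. x + t *\<^sub>R w" and g = f])
      (auto intro!: derivative_eq_intros f)
  then have "((\<lambda>t. f (x + t *\<^sub>R w)) has_real_derivative dir_deriv f w x) (at 0)"
    by (simp add: has_field_derivative_def scaleR mult.commute[of _ "dir_deriv f w x"])
  then show ?thesis by (rule DERIV_imp_deriv)
qed

text \<open>
  The outer derivative at 0 sees only small \<open>s\<close>, for which \<open>x + s v\<close> stays in the open set \<open>S\<close> and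
  the inner derivative is a directional derivative.
\<close>

lemma second_deriv_along_lines:
  fixes f :: "'a::euclidean_space \<Rightarrow> real"
  assumes f: "Cdiff (Suc (Suc k)) S f" and S: "open S" "x \<in> S"
  shows "deriv (\<lambda>s. deriv (\<lambda>t. f (x + s *\<^sub>R v + t *\<^sub>R w)) 0) 0 = dir_deriv (dir_deriv f w) v x"
proof -
  have "deriv (\<lambda>s. deriv (\<lambda>t. f (x + s *\<^sub>R v + t *\<^sub>R w)) 0) 0
      = deriv (\<lambda>s. dir_deriv f w (x + s *\<^sub>R v)) 0"
    by (intro deriv_cong_ev refl eventually_mono[OF eventually_line_in_open[OF S]]
        deriv_along_line[OF f S(1)])
  also have "\<dots> = dir_deriv (dir_deriv f w) v x"
    by (rule deriv_along_line[OF Cdiff_SucD[OF f S(1)] S])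
  finally show ?thesis .
qed

lemma third_deriv_along_lines:
  fixes f :: "'a::euclidean_space \<Rightarrow> real"
  assumes f: "Cdiff (Suc (Suc (Suc k))) S f" and S: "open S" "x \<in> S"
  shows "deriv (\<lambda>r. deriv (\<lambda>s. deriv (\<lambda>t. f (x + r *\<^sub>R u + s *\<^sub>R v + t *\<^sub>R w)) 0) 0) 0
    = dir_deriv (dir_deriv (dir_deriv f w) v) u x"
proof -
  have "deriv (\<lambda>r. deriv (\<lambda>s. deriv (\<lambda>t. f (x + r *\<^sub>R u + s *\<^sub>R v + t *\<^sub>R w)) 0) 0) 0
      = deriv (\<lambda>r. dir_deriv (dir_deriv f w) v (x + r *\<^sub>R u)) 0"
    by (intro deriv_cong_ev refl eventually_mono[OF eventually_line_in_open[OF S]]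
        second_deriv_along_lines[OF f S(1)])
  also have "\<dots> = dir_deriv (dir_deriv (dir_deriv f w) v) u x"
    by (rule deriv_along_line[OF Cdiff_SucD[OF Cdiff_SucD[OF f S(1)] S(1)] S])
  finally show ?thesis .
qed

text \<open>
  Along \<open>y\<close> itself \<open>f\<close> is \<open>(1 + s + t)\<^sup>2 f y\<close>. This is Euler's identity in the form needed both to
  recover a quadratic form from its Hessian and to see that a Minkowski norm is positive.
\<close>

lemma second_deriv_of_homogeneous:
  fixes f :: "'a::real_normed_vector \<Rightarrow> real"
  assumes hom: "\<And>c. 0 < c \<Longrightarrow> f (c *\<^sub>R y) = c\<^sup>2 * f y"
  shows "deriv (\<lambda>s. deriv (\<lambda>t. f (y + s *\<^sub>R y + t *\<^sub>R y)) 0) 0 = 2 * f y"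
proof -
  have inner: "deriv (\<lambda>t. f (y + s *\<^sub>R y + t *\<^sub>R y)) 0 = 2 * (1 + s) * f y" if "-1 < s" for s
  proof -
    have "f (y + s *\<^sub>R y + t *\<^sub>R y) = (1 + s + t)\<^sup>2 * f y" if "- 1 - s < t" for t
      using hom[of "1 + s + t"] that by (simp add: scaleR_add_left)
    moreover have "\<forall>\<^sub>F t in nhds 0. - 1 - s < t"
      using that by (intro eventually_nhds_in_open[where s = "{- 1 - s<..}", simplified]) auto
    ultimately have "deriv (\<lambda>t. f (y + s *\<^sub>R y + t *\<^sub>R y)) 0 = deriv (\<lambda>t. (1 + s + t)\<^sup>2 * f y) 0"
      by (intro deriv_cong_ev refl) (auto elim: eventually_mono)
    also have "\<dots> = 2 * (1 + s) * f y"
      by (rule DERIV_imp_deriv) (auto intro!: derivative_eq_intros)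
    finally show ?thesis .
  qed
  have "\<forall>\<^sub>F s in nhds (0::real). - 1 < s"
    by (intro eventually_nhds_in_open[where s = "{- 1<..}", simplified]) auto
  then have "deriv (\<lambda>s. deriv (\<lambda>t. f (y + s *\<^sub>R y + t *\<^sub>R y)) 0) 0 = deriv (\<lambda>s. 2 * (1 + s) * f y) 0"
    using inner by (intro deriv_cong_ev refl) (auto elim: eventually_mono)
  also have "\<dots> = 2 * f y"
    by (rule DERIV_imp_deriv) (auto intro!: derivative_eq_intros)
  finally show ?thesis .
qed

text \<open>
  The Hessian \<open>H\<close> is constant on the connected punctured space, and homogeneity gives
  \<open>H y y = 2 f y\<close>. The symmetric part of \<open>H / 2\<close> is therefore the bilinear form sought.
\<close>

lemma quadratic_if_third_derivatives_vanish:
  fixes f :: "'a::euclidean_space \<Rightarrow> real"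
  assumes dim: "2 \<le> DIM('a)"
    and f: "Cdiff 3 (UNIV - {0}) f"
    and third: "\<And>x u v w. x \<noteq> 0 \<Longrightarrow> dir_deriv (dir_deriv (dir_deriv f w) v) u x = 0"
    and hom: "\<And>c y. 0 < c \<Longrightarrow> f (c *\<^sub>R y) = c\<^sup>2 * f y"
  obtains B where "bilinear B" "\<And>x y. B x y = B y x" "\<And>x. x \<noteq> 0 \<Longrightarrow> f x = B x x"
proof -
  let ?S = "UNIV - {0 :: 'a}"
  have S: "open ?S" by simp
  have f3: "Cdiff (Suc (Suc (Suc 0))) ?S f" using f by (simp add: numeral_3_eq_3)
  have f1: "Cdiff (Suc (Suc 0)) ?S (dir_deriv f w)" for w by (rule Cdiff_SucD[OF f3 S])
  have f2: "Cdiff (Suc 0) ?S (dir_deriv (dir_deriv f w) v)" for v w by (rule Cdiff_SucD[OF f1 S])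
  obtain e :: 'a where e: "e \<noteq> 0" using nonzero_Basis nonempty_Basis by blast
  define H where "H v w = dir_deriv (dir_deriv f w) v e" for v w
  have const: "dir_deriv (dir_deriv f w) v x = H v w" if "x \<noteq> 0" for x v w
    unfolding H_def
  proof (rule has_derivative_zero_unique_connected[OF S])
    show "connected ?S" using connected_punctured_universe[OF dim, of 0] by (simp add: Compl_eq_Diff_UNIV)
    show "(dir_deriv (dir_deriv f w) v has_derivative (\<lambda>x. 0)) (at x)" if "x \<in> ?S" for x
    proof -
      have "frechet_derivative (dir_deriv (dir_deriv f w) v) (at x) = (\<lambda>x. 0)"
        using third that by (simp add: fun_eq_iff)
      then show ?thesis using Cdiff_Suc_has_derivative[OF f2 S that] by metis
    qed
  qed (use that e in auto)
  have lin_f: "linear (frechet_derivative f (at x))" if "x \<noteq> 0" for x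
    using Cdiff_Suc_has_derivative[OF f3 S] that has_derivative_linear by fastforce
  have dw: "(dir_deriv f w has_derivative (\<lambda>v. H v w)) (at e)" for w
    using Cdiff_Suc_has_derivative[OF f1 S, of e] e by (simp add: H_def[abs_def])
  have lin1: "linear (\<lambda>v. H v w)" for w using has_derivative_linear[OF dw] .
  have lin2: "linear (H v)" for v
  proof (rule linearI)
    fix w w'
    have "(dir_deriv f (w + w') has_derivative (\<lambda>v. H v w + H v w')) (at e)"
      by (rule has_derivative_transform_within_open[OF has_derivative_add[OF dw dw] S])
        (use e lin_f linear_add in fastforce)+
    from has_derivative_unique[OF this dw] show "H v (w + w') = H v w + H v w'" by metis
  next
    fix c w
    have "(dir_deriv f (c *\<^sub>R w) has_derivative (\<lambda>v. c * H v w)) (at e)"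
      by (rule has_derivative_transform_within_open[OF has_derivative_mult_right[OF dw] S])
        (use e lin_f linear_scale in fastforce)+
    from has_derivative_unique[OF this dw] show "H v (c *\<^sub>R w) = c *\<^sub>R H v w" by (metis real_scaleR_def)
  qed
  define B where "B v w = (H v w + H w v) / 4" for v w
  have "bilinear B" unfolding bilinear_def B_def
    by (auto intro!: linearI simp: linear_add[OF lin1] linear_add[OF lin2]
        linear_scale[OF lin1] linear_scale[OF lin2] field_simps)
  moreover have "f x = B x x" if "x \<noteq> 0" for x
    using second_deriv_of_homogeneous[of f x, OF hom] second_deriv_along_lines[OF f3 S, of x x x] that
      const[OF that] by (simp add: B_def)
  ultimately show ?thesis by (intro that[of B]) (auto simp: B_def)
qed

lemma third_derivatives_of_difference:
  assumes f: "Cdiff 3 S f" and g: "Cdiff 3 S g" and S: "open S"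
    and eq: "\<And>x. x \<in> S \<Longrightarrow> dir_deriv (dir_deriv (dir_deriv f w) v) u x = dir_deriv (dir_deriv (dir_deriv g w) v) u x"
    and x: "x \<in> S"
  shows "dir_deriv (dir_deriv (dir_deriv (\<lambda>x. f x - g x) w) v) u x = 0"
proof -
  have diff: "dir_deriv h w x = dir_deriv h1 w x - dir_deriv h2 w x"
    if "Cdiff (Suc k) S h1" "Cdiff (Suc k) S h2" "\<And>x. x \<in> S \<Longrightarrow> h x = h1 x - h2 x" "x \<in> S"
    for h h1 h2 k w x
  proof -
    have "(h has_derivative (\<lambda>v. dir_deriv h1 v x - dir_deriv h2 v x)) (at x)"
      by (rule has_derivative_transform_within_open[OF has_derivative_diff[OF
            Cdiff_Suc_has_derivative[OF that(1) S] Cdiff_Suc_has_derivative[OF that(2) S]] S])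
        (use that in auto)
    then have "(\<lambda>v. dir_deriv h1 v x - dir_deriv h2 v x) = frechet_derivative h (at x)"
      by (rule frechet_derivative_at)
    then show ?thesis by metis
  qed
  note f3 = f[unfolded numeral_3_eq_3] and g3 = g[unfolded numeral_3_eq_3]
  note f2 = Cdiff_SucD[OF f3 S] and g2 = Cdiff_SucD[OF g3 S]
  note f1 = Cdiff_SucD[OF f2 S] and g1 = Cdiff_SucD[OF g2 S]
  show ?thesis
    using diff[OF f1 g1 diff[OF f2 g2 diff[OF f3 g3 refl]] x] eq[OF x] by simp
qed

section \<open>Minkowski norms\<close>

lemma minkowski_norm_homogeneous: "minkowski_norm F \<Longrightarrow> 0 < c \<Longrightarrow> F (c *\<^sub>R y) = c * F y"
  by (simp add: minkowski_norm_def)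

lemma minkowski_norm_zero: "minkowski_norm F \<Longrightarrow> F 0 = 0"
  using minkowski_norm_homogeneous[of F 2 0] by simp

lemma minkowski_norm_pos:
  assumes "minkowski_norm F" "y \<noteq> 0"
  shows "0 < F y"
proof -
  have "fundamental_form F y y y = (F y)\<^sup>2"
    using second_deriv_of_homogeneous[of "\<lambda>x. (F x)\<^sup>2" y] minkowski_norm_homogeneous[OF assms(1)]
    by (simp add: fundamental_form_def power_mult_distrib)
  moreover have "0 < fundamental_form F y y y" using assms unfolding minkowski_norm_def by blast
  ultimately have "0 < (F y)\<^sup>2" by simp
  moreover have "0 \<le> F y" using assms by (simp add: minkowski_norm_def)
  ultimately show ?thesis by (simp add: less_le)
qed

lemma Cdiff_minkowski_norm_square:
  "minkowski_norm F \<Longrightarrow> Cdiff k (UNIV - {0}) (\<lambda>x. (F x)\<^sup>2)"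
  unfolding power2_eq_square by (intro Cdiff_mult) (auto simp: minkowski_norm_def smooth_on_def)

lemma cartan_torsion_eq_third_derivative:
  assumes "minkowski_norm F" "y \<noteq> 0"
  shows "cartan_torsion F y u v w = 1/4 * dir_deriv (dir_deriv (dir_deriv (\<lambda>x. (F x)\<^sup>2) w) v) u y"
  unfolding cartan_torsion_def
  using third_deriv_along_lines[OF Cdiff_minkowski_norm_square[OF assms(1)], of y u v w] assms(2) by simp

text \<open>
  Compactness of the sphere and homogeneity. This makes the supremum defining
  \<^const>\<open>form_norm\<close> finite.
\<close>

lemma minkowski_norm_lower_bound:
  fixes F :: "real^'n \<Rightarrow> real"
  assumes F: "minkowski_norm F"
  obtains m where "0 < m" "\<And>y. m * norm y \<le> F y"
proof -
  have "continuous_on (UNIV - {0}) F"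
    using F Cdiff_continuous_on[of "UNIV - {0}" 0 F] by (simp add: minkowski_norm_def smooth_on_def)
  then have "continuous_on (sphere 0 1) F" by (rule continuous_on_subset) auto
  moreover have "sphere (0::real^'n) 1 \<noteq> {}" by simp
  ultimately obtain z where z: "z \<in> sphere 0 1" "\<And>y. y \<in> sphere 0 1 \<Longrightarrow> F z \<le> F y"
    using continuous_attains_inf[OF compact_sphere] by metis
  have "F z * norm y \<le> F y" for y
  proof (cases "y = 0")
    case False
    have "F y = F (norm y *\<^sub>R ((1 / norm y) *\<^sub>R y))" using False by simp
    also have "\<dots> = norm y * F ((1 / norm y) *\<^sub>R y)"
      using False by (intro minkowski_norm_homogeneous[OF F]) simp
    also have "\<dots> \<ge> norm y * F z" using False z(2) by (intro mult_left_mono) simp_all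
    finally show ?thesis by (simp add: mult.commute)
  qed (simp add: minkowski_norm_zero[OF F])
  moreover have "z \<noteq> 0" using z(1) by auto
  then have "0 < F z" by (rule minkowski_norm_pos[OF F])
  ultimately show ?thesis using that by blast
qed

lemma abs_form_ratio_le_form_norm:
  fixes F :: "real^'n \<Rightarrow> real"
  assumes F: "minkowski_norm F" and y: "y \<noteq> 0"
  shows "\<bar>blinfun_apply b y\<bar> / F y \<le> form_norm F b"
  unfolding form_norm_def
proof (rule cSUP_upper)
  obtain m where m: "0 < m" "\<And>y. m * norm y \<le> F y" using minkowski_norm_lower_bound[OF F] by blast
  show "bdd_above ((\<lambda>y. \<bar>blinfun_apply b y\<bar> / F y) ` (UNIV - {0}))"
  proof (rule bdd_aboveI2)
    fix x :: "real^'n" assume "x \<in> UNIV - {0}"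
    then have x: "x \<noteq> 0" by simp
    have "\<bar>blinfun_apply b x\<bar> / F x \<le> (norm b * norm x) / (m * norm x)"
      using norm_blinfun[of b x] m x by (intro frac_le) auto
    then show "\<bar>blinfun_apply b x\<bar> / F x \<le> norm b / m" using x by simp
  qed
qed (use y in simp)

text \<open>
  By linearity the sum over the partial derivatives is the derivative in the direction \<open>s\<close>, which
  is the form in which the defect behaves well under radial maps.
\<close>

lemma radial_defect_eq:
  assumes "\<phi> differentiable (at s within D)"
  shows "radial_defect D \<phi> s = \<phi> s - frechet_derivative \<phi> (at s within D) s"
proof -
  interpret bounded_linear "frechet_derivative \<phi> (at s within D)"
    using assms by (simp add: frechet_derivative_works has_derivative_bounded_linear)
  have "s = (\<Sum>i\<in>UNIV. (s $ i) *\<^sub>R axis i 1)"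
    using basis_expansion[of s] by (simp add: scalar_mult_eq_scaleR)
  then have "frechet_derivative \<phi> (at s within D) s
      = frechet_derivative \<phi> (at s within D) (\<Sum>i\<in>UNIV. (s $ i) *\<^sub>R axis i 1)" by simp
  also have "\<dots> = (\<Sum>i\<in>UNIV. s $ i * frechet_derivative \<phi> (at s within D) (axis i 1))"
    by (simp only: sum scaleR real_scaleR_def)
  finally show ?thesis by (simp add: radial_defect_def partial_deriv_within_def)
qed

section \<open>Deformations with equal Cartan torsion\<close>

lemma smooth_on_sqrt_shifted_square:
  assumes \<phi>: "smooth_on X \<phi>" and X: "open X" and pos: "\<And>s. s \<in> X \<Longrightarrow> 0 < \<epsilon> * ((\<phi> s)\<^sup>2 - 1)"
  shows "smooth_on X (\<lambda>s. sqrt (\<epsilon> * ((\<phi> s)\<^sup>2 - 1)))"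
  unfolding smooth_on_def
proof
  fix k
  have "Cdiff k X (\<lambda>s. \<epsilon> * (\<phi> s * \<phi> s + (-1)))"
    using \<phi> by (intro Cdiff_mult Cdiff_add Cdiff_const X) (auto simp: smooth_on_def)
  then have "Cdiff k X (\<lambda>s. \<epsilon> * ((\<phi> s)\<^sup>2 - 1))" by (simp add: power2_eq_square)
  then show "Cdiff k X (\<lambda>s. sqrt (\<epsilon> * ((\<phi> s)\<^sup>2 - 1)))"
    by (intro Cdiff_compose_real[where h = sqrt, OF X _ _ Cdiff_sqrt]) (use pos in auto)
qed

text \<open>
  With \<open>\<psi>\<^sup>2 = \<epsilon> (\<phi>\<^sup>2 - 1)\<close> one has \<open>\<psi> D\<psi> = \<epsilon> \<phi> D\<phi>\<close>, hence
  \<open>\<psi> (\<psi> - D\<psi>(s) s) = \<epsilon> (\<phi> (\<phi> - D\<phi>(s) s) - 1)\<close>: the second factor of the sign hypothesis on \<open>\<phi>\<close> is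
  the condition that makes the radial map of \<open>\<psi>\<close> injective.
\<close>

lemma sqrt_shifted_square_gap:
  assumes \<phi>: "(\<phi> has_derivative \<phi>') (at s)"
    and pos: "0 < \<epsilon> * ((\<phi> s)\<^sup>2 - 1)" and gap: "0 < \<epsilon> * (\<phi> s * (\<phi> s - \<phi>' s) - 1)"
  shows "frechet_derivative (\<lambda>s. sqrt (\<epsilon> * ((\<phi> s)\<^sup>2 - 1))) (at s) s < sqrt (\<epsilon> * ((\<phi> s)\<^sup>2 - 1))"
proof -
  let ?\<psi> = "\<lambda>s. sqrt (\<epsilon> * ((\<phi> s)\<^sup>2 - 1))"
  have inner: "((\<lambda>s. \<epsilon> * ((\<phi> s)\<^sup>2 - 1)) has_derivative (\<lambda>v. \<epsilon> * (2 * \<phi> s * \<phi>' v))) (at s)"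
    by (auto intro!: derivative_eq_intros \<phi>)
  have "(sqrt has_derivative (*) (inverse (?\<psi> s) / 2)) (at (\<epsilon> * ((\<phi> s)\<^sup>2 - 1)))"
    using DERIV_real_sqrt[OF pos] by (simp add: has_field_derivative_def)
  from has_derivative_compose[OF inner this]
  have "(?\<psi> has_derivative (\<lambda>v. inverse (?\<psi> s) / 2 * (\<epsilon> * (2 * \<phi> s * \<phi>' v)))) (at s)" .
  then have "(\<lambda>v. inverse (?\<psi> s) / 2 * (\<epsilon> * (2 * \<phi> s * \<phi>' v))) = frechet_derivative ?\<psi> (at s)"
    by (rule frechet_derivative_at)
  moreover have "inverse q / 2 * (\<epsilon> * (2 * p * r)) = \<epsilon> * (p * r) / q" for p q r :: real
    by (simp add: field_simps)
  ultimately have D: "frechet_derivative ?\<psi> (at s) s = \<epsilon> * (\<phi> s * \<phi>' s) / ?\<psi> s"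
    by metis
  have p: "0 < ?\<psi> s" using pos by simp
  have "\<epsilon> * (\<phi> s * \<phi>' s) < ?\<psi> s * ?\<psi> s"
    using gap pos by (simp add: power2_eq_square algebra_simps)
  then show ?thesis unfolding D using p by (simp add: pos_divide_less_eq)
qed

text \<open>
  The box may be any one inside the image of the radial map, since regularity and positivity of the
  defect hold on the whole image.
\<close>

lemma admissible_pushforward:
  fixes X :: "(real^'p) set" and d :: "real^'p" and b :: "'p \<Rightarrow> (real^'n) \<Rightarrow>\<^sub>L real"
  assumes R: "radial_inversion X \<psi>"
    and norm: "\<And>i. form_norm \<alpha> (b i) < d $ i" and d: "\<And>i. 0 < d $ i"
    and sub: "cbox (- d) d \<subseteq> radial_inversion.radial \<psi> ` X"
    and h: "smooth_on X h" "\<And>x. x \<in> X \<Longrightarrow> 0 < h x"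
      "\<And>x. x \<in> X \<Longrightarrow> frechet_derivative h (at x) x < h x"
  shows "admissible_deformation \<alpha> b d (radial_inversion.pushforward X \<psi> h)"
proof -
  interpret radial_inversion X \<psi> by (rule R)
  have hk: "Cdiff k X h" for k using h(1) by (simp add: smooth_on_def)
  let ?g = "pushforward h"
  have g: "Cdiff k (radial ` X) ?g" for k by (rule Cdiff_pushforward[OF hk])
  have lt: "- d \<bullet> i < d \<bullet> i" if "i \<in> Basis" for i
    using that d by (auto simp: Basis_vec_def inner_axis)
  have box: "Cdiff k (cbox (- d) d) ?g" for k
    by (rule Cdiff_cbox_subset[OF open_radial_image sub lt g])
  have "0 < ?g s \<and> 0 < radial_defect (cbox (- d) d) ?g s" if s: "s \<in> cbox (- d) d" for s
  proof -
    obtain x where x: "x \<in> X" "s = radial x" using s sub by blast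
    have der: "(?g has_derivative frechet_derivative ?g (at s)) (at s)"
      using Cdiff_Suc_has_derivative[OF g open_radial_image] x by blast
    have w: "frechet_derivative ?g (at s within cbox (- d) d) = frechet_derivative ?g (at s)"
      by (rule frechet_derivative_within_cbox[OF lt s has_derivative_at_withinI[OF der]])
    have "radial_defect (cbox (- d) d) ?g s = ?g s - frechet_derivative ?g (at s) s"
      using radial_defect_eq[OF differentiableI[OF has_derivative_at_withinI[OF der]]] w by metis
    also have "\<dots> = (h x - frechet_derivative h (at x) x) / (\<psi> x - D x x)"
      unfolding x(2) by (rule pushforward_gap[OF x(1) Cdiff_Suc_has_derivative[OF hk open_X x(1)]])
    also have "\<dots> > 0" using h(3)[OF x(1)] gap[OF x(1)] by simp
    finally show ?thesis using x pos[OF x(1)] h(2)[OF x(1)]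
      by (simp add: pushforward_def radial_inv_radial)
  qed
  then show ?thesis using norm box unfolding admissible_deformation_def smooth_on_def by blast
qed

theorem corollary3:
  fixes F Fbar :: "real^'n \<Rightarrow> real"
    and b :: "'p::finite \<Rightarrow> (real^'n) \<Rightarrow>\<^sub>L real"
    and d :: "real^'p"
    and \<phi> :: "real^'p \<Rightarrow> real"
  assumes "2 \<le> CARD('n)"
    and "minkowski_norm F"
    and "CARD('p) \<le> CARD('n)"
    and "inj b" and "independent (range b)"
    and "admissible_deformation F b d \<phi>"
    and "Fbar = deformation b \<phi> F"
    and "minkowski_norm Fbar"
    and "\<And>y u v w. y \<noteq> 0 \<Longrightarrow> cartan_torsion Fbar y u v w = cartan_torsion F y u v w"
    and "\<And>s. s \<in> cbox (- d) d \<Longrightarrow>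
           0 < (\<phi> s - 1) * (\<phi> s * radial_defect (cbox (- d) d) \<phi> s - 1)"
  shows "(\<forall>y. y \<noteq> 0 \<longrightarrow> \<phi> (form_ratio b F y) \<noteq> 1) \<and>
    (\<exists>\<alpha> d' \<phi>\<^sub>1 \<phi>\<^sub>2.
       euclidean_norm \<alpha> \<and>
       admissible_deformation \<alpha> b d' \<phi>\<^sub>1 \<and> F = deformation b \<phi>\<^sub>1 \<alpha> \<and>
       admissible_deformation \<alpha> b d' \<phi>\<^sub>2 \<and> Fbar = deformation b \<phi>\<^sub>2 \<alpha> \<and>
       (\<forall>s\<in>cbox (- d') d'.
          (1 / \<phi>\<^sub>1 s) *\<^sub>R s \<in> cbox (- d) d \<and>
          \<phi>\<^sub>2 s = \<phi>\<^sub>1 s * \<phi> ((1 / \<phi>\<^sub>1 s) *\<^sub>R s)))"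
proof -
  note F = assms(2) and Fbar = assms(8)
  let ?X = "box (- d) d" and ?C = "cbox (- d) d"
  have XC: "?X \<subseteq> ?C" by (rule box_subset_cbox)
  have adm: "\<And>i. form_norm F (b i) < d $ i" "smooth_on ?C \<phi>" "\<And>s. s \<in> ?C \<Longrightarrow> 0 < \<phi> s"
    "\<And>s. s \<in> ?C \<Longrightarrow> 0 < radial_defect ?C \<phi> s"
    using assms(6) by (auto simp: admissible_deformation_def)
  have norm_nonneg: "0 \<le> form_norm F (b i)" for i
  proof -
    have "(1::real^'n) \<noteq> 0" by simp
    from abs_form_ratio_le_form_norm[OF F this, of "b i"] minkowski_norm_pos[OF F this]
    show ?thesis by (meson divide_nonneg_pos abs_ge_zero order_trans)
  qed
  have ratio: "\<bar>form_ratio b F y $ i\<bar> \<le> form_norm F (b i)" if "y \<noteq> 0" for y i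
    using abs_form_ratio_le_form_norm[OF F that, of "b i"] minkowski_norm_pos[OF F that]
    by (simp add: form_ratio_def)
  have ratio_X: "form_ratio b F y \<in> ?X" if "y \<noteq> 0" for y
    unfolding mem_box_cart
  proof
    fix i show "(- d) $ i < form_ratio b F y $ i \<and> form_ratio b F y $ i < d $ i"
      using ratio[OF that, of i] adm(1)[of i] by (simp add: abs_le_iff)
  qed
  have ne1: "\<phi> s \<noteq> 1" if "s \<in> ?C" for s using assms(10)[OF that] by auto
  have cont: "continuous_on ?C \<phi>" using adm(2) unfolding smooth_on_def
    by (metis times_continuously_differentiable_on.simps(1))
  obtain \<epsilon> :: real where \<epsilon>: "\<epsilon> = 1 \<or> \<epsilon> = -1" "\<And>s. s \<in> ?C \<Longrightarrow> 0 < \<epsilon> * (\<phi> s - 1)"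
  proof -
    have "connected (\<phi> ` ?C)"
      by (rule connected_continuous_image[OF cont convex_connected[OF convex_box(1)]])
    then have "1 \<in> \<phi> ` ?C" if "s \<in> ?C" "t \<in> ?C" "\<phi> s \<le> 1" "1 \<le> \<phi> t" for s t
      using that unfolding connected_iff_interval by blast
    then have "(\<forall>s\<in>?C. 1 < \<phi> s) \<or> (\<forall>s\<in>?C. \<phi> s < 1)"
      using ne1 by (metis imageE linorder_not_le)
    then show ?thesis using that[of 1] that[of "-1"] by fastforce
  qed
  have eps_sq: "0 < \<epsilon> * ((\<phi> s)\<^sup>2 - 1)" if "s \<in> ?C" for s
  proof -
    have "\<epsilon> * ((\<phi> s)\<^sup>2 - 1) = (\<epsilon> * (\<phi> s - 1)) * (\<phi> s + 1)"
      by (simp add: power2_eq_square algebra_simps)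
    also have "\<dots> > 0" by (rule mult_pos_pos[OF \<epsilon>(2)[OF that]]) (use adm(3)[OF that] in simp)
    finally show ?thesis .
  qed
  have eps_gap: "0 < \<epsilon> * (\<phi> s * radial_defect ?C \<phi> s - 1)" if "s \<in> ?C" for s
    using assms(10)[OF that] \<epsilon>(1) \<epsilon>(2)[OF that] by (auto simp: zero_less_mult_iff)
  have smX: "smooth_on ?X \<phi>"
    using adm(2) Cdiff_open_subset[OF open_box XC] by (auto simp: smooth_on_def)
  then have derX: "(\<phi> has_derivative frechet_derivative \<phi> (at s)) (at s)" if "s \<in> ?X" for s
    using Cdiff_Suc_has_derivative[OF _ open_box that, of 0] by (metis smooth_on_def)
  have defX: "radial_defect ?C \<phi> s = \<phi> s - frechet_derivative \<phi> (at s) s" if "s \<in> ?X" for s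
  proof -
    have "at s within ?C = at s"
      using that by (metis at_within_interior interior_cbox)
    then show ?thesis using radial_defect_eq[of \<phi> s ?C] derX[OF that] by (metis differentiableI)
  qed
  define \<psi> where "\<psi> s = sqrt (\<epsilon> * ((\<phi> s)\<^sup>2 - 1))" for s
  have \<psi>_pos: "0 < \<psi> s" if "s \<in> ?X" for s using eps_sq that XC by (auto simp: \<psi>_def)
  obtain M where M: "\<And>s. s \<in> ?X \<Longrightarrow> \<psi> s \<le> M"
  proof -
    have "continuous_on ?C \<psi>" unfolding \<psi>_def by (intro continuous_intros cont)
    then have "bounded (\<psi> ` ?C)" by (intro compact_imp_bounded compact_continuous_image compact_cbox)
    then obtain M where "\<forall>s\<in>?C. \<bar>\<psi> s\<bar> \<le> M" unfolding bounded_iff by auto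
    then show ?thesis using that[of M] XC by fastforce
  qed
  obtain B where B: "bilinear B" "\<And>x y. B x y = B y x"
    "\<And>x. x \<noteq> 0 \<Longrightarrow> (Fbar x)\<^sup>2 - (F x)\<^sup>2 = B x x"
  proof (rule quadratic_if_third_derivatives_vanish[of "\<lambda>x. (Fbar x)\<^sup>2 - (F x)\<^sup>2"])
    have "Cdiff 3 (UNIV - {0}) (\<lambda>x. (Fbar x)\<^sup>2 + (-1) * (F x)\<^sup>2)"
      by (intro Cdiff_add Cdiff_mult Cdiff_const Cdiff_minkowski_norm_square F Fbar open_punctured)
    then show "Cdiff 3 (UNIV - {0}) (\<lambda>x. (Fbar x)\<^sup>2 - (F x)\<^sup>2)" by simp
    show "(Fbar (c *\<^sub>R y))\<^sup>2 - (F (c *\<^sub>R y))\<^sup>2 = c\<^sup>2 * ((Fbar y)\<^sup>2 - (F y)\<^sup>2)" if "0 < c" for c y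
      using that by (simp add: minkowski_norm_homogeneous F Fbar power_mult_distrib right_diff_distrib)
    show "dir_deriv (dir_deriv (dir_deriv (\<lambda>x. (Fbar x)\<^sup>2 - (F x)\<^sup>2) w) v) u x = 0" if "x \<noteq> 0" for x u v w
    proof (rule third_derivatives_of_difference[where S = "UNIV - {0}"])
      show "dir_deriv (dir_deriv (dir_deriv (\<lambda>x. (Fbar x)\<^sup>2) w) v) u x
          = dir_deriv (dir_deriv (dir_deriv (\<lambda>x. (F x)\<^sup>2) w) v) u x" if "x \<in> UNIV - {0}" for x
        using assms(9)[of x u v w] that by (simp add: cartan_torsion_eq_third_derivative F Fbar)
    qed (use that in \<open>auto intro: Cdiff_minkowski_norm_square F Fbar\<close>)
  qed (use assms(1) in auto)
  define \<alpha> where "\<alpha> y = sqrt (\<epsilon> * B y y)" for y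
  have \<alpha>_eq: "\<alpha> y = F y * \<psi> (form_ratio b F y)" if "y \<noteq> 0" for y
  proof -
    have "B y y = (F y)\<^sup>2 * ((\<phi> (form_ratio b F y))\<^sup>2 - 1)"
      using B(3)[OF that, symmetric] by (simp add: assms(7) deformation_def power_mult_distrib algebra_simps)
    then have "\<epsilon> * B y y = (F y)\<^sup>2 * (\<epsilon> * ((\<phi> (form_ratio b F y))\<^sup>2 - 1))" by simp
    then have "\<alpha> y = \<bar>F y\<bar> * \<psi> (form_ratio b F y)"
      by (simp only: \<alpha>_def \<psi>_def real_sqrt_mult real_sqrt_abs)
    then show ?thesis using minkowski_norm_pos[OF F that] by simp
  qed
  have \<alpha>_pos: "0 < \<alpha> y" if "y \<noteq> 0" for y
    using \<alpha>_eq[OF that] minkowski_norm_pos[OF F that] \<psi>_pos[OF ratio_X[OF that]] by simp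
  have \<alpha>_zero: "\<alpha> 0 = 0" by (simp add: \<alpha>_def bilinear_lzero[OF B(1)])
  have "inner_product (\<lambda>x y. \<epsilon> * B x y)"
    unfolding inner_product_def
  proof (intro conjI allI impI)
    show "bilinear (\<lambda>x y. \<epsilon> * B x y)"
      using B(1) unfolding bilinear_def by (auto intro: linear_compose_scale_right[where 'b = real, simplified])
    show "\<epsilon> * B x y = \<epsilon> * B y x" for x y using B(2) by simp
    show "0 < \<epsilon> * B x x" if "x \<noteq> 0" for x using \<alpha>_pos[OF that] by (simp add: \<alpha>_def)
  qed
  then have euclid: "euclidean_norm \<alpha>" unfolding euclidean_norm_def \<alpha>_def by blast
  \<comment> \<open>Any bound larger than all the norms of the 1-forms would do; the truncation below adapts to it.\<close>
  define K where "K = 1 + (\<Sum>i\<in>UNIV. \<bar>form_norm \<alpha> (b i)\<bar>)"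
  have K: "0 < K" "\<And>i. form_norm \<alpha> (b i) < K"
  proof -
    show "0 < K" by (simp add: K_def add_pos_nonneg sum_nonneg)
    fix i have "\<bar>form_norm \<alpha> (b i)\<bar> \<le> (\<Sum>i\<in>UNIV. \<bar>form_norm \<alpha> (b i)\<bar>)"
      by (rule member_le_sum) auto
    then show "form_norm \<alpha> (b i) < K" by (simp add: K_def)
  qed
  define a :: "real^'p" where "a = (\<chi> i. form_norm F (b i))"
  \<comment> \<open>The half-widths \<open>a\<close> are the norms with respect to \<open>F\<close>, so \<open>\<psi>\<close> is unchanged at all values of \<open>\<beta>/F\<close>.\<close>
  obtain \<psi>' where R: "radial_inversion ?X \<psi>'"
    and \<psi>'_eq: "\<And>x. (\<And>i. i \<in> Basis \<Longrightarrow> \<bar>x \<bullet> i\<bar> \<le> a \<bullet> i) \<Longrightarrow> \<psi>' x = \<psi> x"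
    and onto: "\<And>z. (\<And>i. i \<in> Basis \<Longrightarrow> \<bar>z \<bullet> i\<bar> \<le> K) \<Longrightarrow> z \<in> radial_inversion.radial \<psi>' ` ?X"
  proof (rule exists_truncated_radial_profile[of d \<psi> M "\<lambda>i. a \<bullet> i" K])
    show "smooth_on ?X \<psi>" unfolding \<psi>_def
      by (rule smooth_on_sqrt_shifted_square[OF smX open_box]) (use eps_sq XC in blast)
    show "frechet_derivative \<psi> (at x) x < \<psi> x" if "x \<in> ?X" for x
      unfolding \<psi>_def[abs_def]
      by (rule sqrt_shifted_square_gap[OF derX[OF that]])
        (use eps_sq eps_gap XC that defX[OF that] in force)+
    show "0 \<le> a \<bullet> i" "a \<bullet> i < d \<bullet> i" if "i \<in> Basis" for i
      using that norm_nonneg adm(1) by (auto simp: a_def Basis_vec_def inner_axis)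
  qed (use \<psi>_pos M K(1) in auto)
  interpret radial_inversion ?X \<psi>' by (rule R)
  define d' :: "real^'p" where "d' = (\<chi> i. K)"
  have sub: "cbox (- d') d' \<subseteq> radial ` ?X"
  proof
    fix z assume z: "z \<in> cbox (- d') d'"
    show "z \<in> radial ` ?X"
    proof (rule onto)
      fix i :: "real^'p" assume "i \<in> Basis"
      then obtain j where "i = axis j 1" by (auto simp: Basis_vec_def)
      moreover have "\<bar>z $ j\<bar> \<le> K" using z by (auto simp: mem_box_cart d'_def abs_le_iff minus_le_iff)
      ultimately show "\<bar>z \<bullet> i\<bar> \<le> K" by (simp add: inner_axis)
    qed
  qed
  let ?\<phi>1 = "pushforward (\<lambda>_. 1)" and ?\<phi>2 = "pushforward \<phi>"
  have adm1: "admissible_deformation \<alpha> b d' ?\<phi>1"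
    by (rule admissible_pushforward[OF R _ _ sub])
      (use K in \<open>auto simp: d'_def smooth_on_def intro: Cdiff_const\<close>)
  have adm2: "admissible_deformation \<alpha> b d' ?\<phi>2"
  proof (rule admissible_pushforward[OF R _ _ sub smX])
    fix x assume x: "x \<in> ?X"
    show "0 < \<phi> x" "frechet_derivative \<phi> (at x) x < \<phi> x"
      using adm(3)[of x] adm(4)[of x] defX[OF x] x XC by auto
  qed (use K in \<open>auto simp: d'_def\<close>)
  have at_ratio: "F y = deformation b ?\<phi>1 \<alpha> y \<and> Fbar y = deformation b ?\<phi>2 \<alpha> y" for y
  proof (cases "y = 0")
    case True
    then show ?thesis
      by (simp add: deformation_def \<alpha>_zero minkowski_norm_zero[OF F] minkowski_norm_zero[OF Fbar])
  next
    case False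
    define x where "x = form_ratio b F y"
    have x: "x \<in> ?X" using ratio_X[OF False] by (simp add: x_def)
    have "\<psi>' x = \<psi> x"
      by (rule \<psi>'_eq) (use ratio[OF False] in \<open>auto simp: x_def a_def Basis_vec_def inner_axis\<close>)
    then have p: "0 < \<psi> x" "\<psi>' x = \<psi> x" using \<psi>_pos[OF x] by auto
    have xi: "x $ i = blinfun_apply (b i) y / F y" for i by (simp add: x_def form_ratio_def)
    have \<alpha>y: "\<alpha> y = F y * \<psi> x" using \<alpha>_eq[OF False] by (simp add: x_def)
    \<comment> \<open>Here the truncated profile still agrees with \<open>\<psi>\<close>, so \<open>\<beta>/\<alpha>\<close> is the radial image of \<open>\<beta>/F\<close>.\<close>
    have "form_ratio b \<alpha> y = radial x"
      by (simp add: form_ratio_def[of b \<alpha>] vec_eq_iff radial_def p \<alpha>y xi)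
    then show ?thesis using p
      by (simp add: deformation_def pushforward_def radial_inv_radial[OF x] \<alpha>y x_def[symmetric] assms(7))
  qed
  have compose: "(1 / ?\<phi>1 s) *\<^sub>R s \<in> ?C \<and> ?\<phi>2 s = ?\<phi>1 s * \<phi> ((1 / ?\<phi>1 s) *\<^sub>R s)"
    if s: "s \<in> cbox (- d') d'" for s
  proof -
    obtain x where x: "x \<in> ?X" "s = radial x" using sub s by blast
    have "?\<phi>1 s = 1 / \<psi>' x" "?\<phi>2 s = \<phi> x / \<psi>' x"
      by (simp_all add: pushforward_def x radial_inv_radial)
    moreover have "\<psi>' x *\<^sub>R s = x" using pos[OF x(1)] by (simp add: x(2) radial_def)
    ultimately show ?thesis using x(1) XC by auto
  qed
  have "\<forall>y. y \<noteq> 0 \<longrightarrow> \<phi> (form_ratio b F y) \<noteq> 1" using ne1 ratio_X XC by blast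
  moreover have "F = deformation b ?\<phi>1 \<alpha>" "Fbar = deformation b ?\<phi>2 \<alpha>"
    using at_ratio by auto
  ultimately show ?thesis using euclid adm1 adm2 compose by blast
qed

end
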